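(* Let $p\ge 2$ be an integer. The growth rate $\zeta_p$ of the monoid $F_+(p)$ of positive elements in the group $F(p)$, where $F(p)$ is generated by $x_0,x_1,\dots,x_{p-1}$, is a root of the equation $$(y^2-1)^{p-1}(y^2+y-1)=y^{2p}.$$ This number has the form $\zeta_p=p+\lambda_p$, where $0<\lambda_p<1/2$ for all $p\ge2$, and $\lambda_p\to 1/2$ as $p\to\infty$.
   Context: For an integer $p\ge2$, the generalized Thompson group $F(p)$ is the group given by the presentation $\langle x_i\ (i\ge0)\mid x_jx_i=x_ix_{j+p-1}\ (0\le i<j)\rangle$. It is generated by $x_0,x_1,\dots,x_{p-1}$. The submonoid $F_+(p)\subset F(p)$ is the set of all elements that can be expressed as products of the generators $x_i$ ($i\ge0$) with no inverses (it includes the identity); its elements are called positive. Let $\ell(g)$ denote the word length of $g\in F(p)$ with respect to the finite generating set $\{x_0,\dots,x_{p-1}\}$ (inverses allowed), and let $\mathbf B(n)=\{g\in F(p):\ell(g)\le n\}$. The growth rate of $F_+(p)$ is $\lim_{n\to\infty}\bigl(\#(F_+(p)\cap\mathbf B(n))\bigr)^{1/n}$. *)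

theory Defs
  imports Complex_Main "HOL-Algebra.Generated_Groups"
begin

section \<open>Groups given by generators and relations\<close>

text \<open>A word over the generating symbols \<open>'a\<close> is a list of letters: \<open>(a, True)\<close> stands for the
  generator \<open>a\<close> and \<open>(a, False)\<close> for its formal inverse.\<close>

type_synonym 'a gword = "('a \<times> bool) list"

inductive pres_eq :: "('a gword \<times> 'a gword) set \<Rightarrow> 'a gword \<Rightarrow> 'a gword \<Rightarrow> bool" for R where
  refl: "pres_eq R u u"
| sym: "pres_eq R u v \<Longrightarrow> pres_eq R v u"
| trans: "pres_eq R u v \<Longrightarrow> pres_eq R v w \<Longrightarrow> pres_eq R u w"
| cancel: "pres_eq R (u @ [(a, b), (a, \<not> b)] @ v) (u @ v)"
| relation: "(l, r) \<in> R \<Longrightarrow> pres_eq R (u @ l @ v) (u @ r @ v)"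

definition pres_class :: "('a gword \<times> 'a gword) set \<Rightarrow> 'a gword \<Rightarrow> 'a gword set" where
  "pres_class R w = {v. pres_eq R w v}"

text \<open>The group with generating symbols all of \<open>'a\<close> and defining relations \<open>l = r\<close> for
  \<open>(l, r) \<in> R\<close>.\<close>

definition presented_group :: "('a gword \<times> 'a gword) set \<Rightarrow> 'a gword set monoid" where
  "presented_group R = \<lparr> carrier = range (pres_class R),
     mult = (\<lambda>A B. {w. \<exists>u\<in>A. \<exists>v\<in>B. pres_eq R (u @ v) w}),
     one = pres_class R [] \<rparr>"

lemma pres_class_eq_iff: "pres_class R u = pres_class R v \<longleftrightarrow> pres_eq R u v"
  unfolding pres_class_def
  by (auto intro: pres_eq.intros dest: pres_eq.trans pres_eq.sym)

lemma pres_eq_append_left: "pres_eq R u v \<Longrightarrow> pres_eq R (w @ u) (w @ v)"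
proof (induction rule: pres_eq.induct)
  case (cancel u a b v)
  show ?case using pres_eq.cancel[of R "w @ u" a b v] by simp
next
  case (relation l r u v)
  then show ?case using pres_eq.relation[of l r R "w @ u" v] by simp
qed (blast intro: pres_eq.intros)+

lemma pres_eq_append_right: "pres_eq R u v \<Longrightarrow> pres_eq R (u @ w) (v @ w)"
proof (induction rule: pres_eq.induct)
  case (cancel u a b v)
  show ?case using pres_eq.cancel[of R u a b "v @ w"] by simp
next
  case (relation l r u v)
  then show ?case using pres_eq.relation[of l r R u "v @ w"] by simp
qed (blast intro: pres_eq.intros)+

lemma pres_eq_append: "pres_eq R u u' \<Longrightarrow> pres_eq R v v' \<Longrightarrow> pres_eq R (u @ v) (u' @ v')"
  by (meson pres_eq.trans pres_eq_append_left pres_eq_append_right)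

lemma carrier_presented_group: "carrier (presented_group R) = range (pres_class R)"
  by (simp add: presented_group_def)

lemma one_presented_group: "\<one>\<^bsub>presented_group R\<^esub> = pres_class R []"
  by (simp add: presented_group_def)

lemma mult_presented_group:
  "pres_class R u \<otimes>\<^bsub>presented_group R\<^esub> pres_class R v = pres_class R (u @ v)"
  unfolding presented_group_def pres_class_def
  by (auto intro: pres_eq.refl pres_eq.trans pres_eq_append)

lemma pres_eq_inverse: "pres_eq R (rev (map (apsnd Not) w) @ w) []"
proof (induction w)
  case Nil
  show ?case by (simp add: pres_eq.refl)
next
  case (Cons c w)
  obtain a b where c: "c = (a, b)" by fastforce
  have "pres_eq R (rev (map (apsnd Not) w) @ [(a, \<not> b), (a, \<not> \<not> b)] @ w)
      (rev (map (apsnd Not) w) @ w)"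
    by (rule pres_eq.cancel)
  then show ?case using Cons c by (auto intro: pres_eq.trans)
qed

lemma group_presented_group: "group (presented_group R)"
proof (rule groupI)
  fix g assume "g \<in> carrier (presented_group R)"
  then obtain w where w: "g = pres_class R w" by (auto simp: carrier_presented_group)
  show "\<exists>h\<in>carrier (presented_group R). h \<otimes>\<^bsub>presented_group R\<^esub> g = \<one>\<^bsub>presented_group R\<^esub>"
    by (rule bexI[of _ "pres_class R (rev (map (apsnd Not) w))"])
      (auto simp: w carrier_presented_group mult_presented_group one_presented_group
        pres_class_eq_iff pres_eq_inverse)
qed (auto simp: carrier_presented_group mult_presented_group one_presented_group)

section \<open>Word length with respect to a generating set\<close>

definition list_prod :: "('g, 'm) monoid_scheme \<Rightarrow> 'g list \<Rightarrow> 'g" where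
  "list_prod G gs = foldr (\<otimes>\<^bsub>G\<^esub>) gs \<one>\<^bsub>G\<^esub>"

text \<open>The value is unspecified when \<open>g\<close> does not lie in the subgroup generated by \<open>S\<close>.\<close>

definition word_length :: "('g, 'm) monoid_scheme \<Rightarrow> 'g set \<Rightarrow> 'g \<Rightarrow> nat" where
  "word_length G S g =
     (LEAST n. \<exists>gs. set gs \<subseteq> S \<union> m_inv G ` S \<and> length gs = n \<and> list_prod G gs = g)"

definition word_ball :: "('g, 'm) monoid_scheme \<Rightarrow> 'g set \<Rightarrow> nat \<Rightarrow> 'g set" where
  "word_ball G S n = {g \<in> carrier G. word_length G S g \<le> n}"

section \<open>The generalized Thompson groups\<close>

definition thompson_rels :: "nat \<Rightarrow> (nat gword \<times> nat gword) set" where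
  "thompson_rels p =
     {([(j, True), (i, True)], [(i, True), (j + p - 1, True)]) | i j. i < j}"

definition thompson_group :: "nat \<Rightarrow> nat gword set monoid" where
  "thompson_group p = presented_group (thompson_rels p)"

definition thompson_gen :: "nat \<Rightarrow> nat \<Rightarrow> nat gword set" where
  "thompson_gen p i = pres_class (thompson_rels p) [(i, True)]"

definition thompson_gens :: "nat \<Rightarrow> nat gword set set" where
  "thompson_gens p = thompson_gen p ` {0..p - 1}"

definition thompson_positive :: "nat \<Rightarrow> nat gword set set" where
  "thompson_positive p =
     {list_prod (thompson_group p) (map (thompson_gen p) is) | is. True}"

definition positive_count :: "nat \<Rightarrow> nat \<Rightarrow> nat" where
  "positive_count p n =
     card (thompson_positive p \<inter> word_ball (thompson_group p) (thompson_gens p) n)"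

definition positive_growth_rate :: "nat \<Rightarrow> real" where
  "positive_growth_rate p = lim (\<lambda>n. root n (real (positive_count p n)))"

subsection \<open>Well-definedness of the word length and the counting function\<close>

lemma group_thompson_group: "group (thompson_group p)"
  unfolding thompson_group_def by (rule group_presented_group)

lemma thompson_gen_closed: "thompson_gen p i \<in> carrier (thompson_group p)"
  by (simp add: thompson_gen_def thompson_group_def carrier_presented_group)

lemma thompson_gens_closed: "thompson_gens p \<subseteq> carrier (thompson_group p)"
  by (auto simp: thompson_gens_def thompson_gen_closed)

lemma thompson_relation:
  assumes "i < j"
  shows "thompson_gen p j \<otimes>\<^bsub>thompson_group p\<^esub> thompson_gen p i =
    thompson_gen p i \<otimes>\<^bsub>thompson_group p\<^esub> thompson_gen p (j + p - 1)"
proof -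
  have "([(j, True), (i, True)], [(i, True), (j + p - 1, True)]) \<in> thompson_rels p"
    using assms by (auto simp: thompson_rels_def)
  from pres_eq.relation[OF this, of "[]" "[]"] show ?thesis
    by (simp add: thompson_gen_def thompson_group_def mult_presented_group pres_class_eq_iff)
qed

lemma thompson_gen_in_generate:
  assumes "p \<ge> 2"
  shows "thompson_gen p k \<in> generate (thompson_group p) (thompson_gens p)"
proof (induction k rule: less_induct)
  case (less k)
  interpret G: group "thompson_group p" by (rule group_thompson_group)
  show ?case
  proof (cases "k \<le> p - 1")
    case True
    then show ?thesis by (auto simp: thompson_gens_def intro: generate.incl)
  next
    case False
    define j where "j = k - (p - 1)"
    have j: "0 < j" "j < k" "k = j + p - 1" using False assms by (auto simp: j_def)
    have 0: "thompson_gen p 0 \<in> thompson_gens p" by (auto simp: thompson_gens_def)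
    have eq: "thompson_gen p k = inv\<^bsub>thompson_group p\<^esub> thompson_gen p 0
        \<otimes>\<^bsub>thompson_group p\<^esub> (thompson_gen p j \<otimes>\<^bsub>thompson_group p\<^esub> thompson_gen p 0)"
      using thompson_relation[OF j(1), of p] j(3)
      by (metis G.inv_solve_left G.m_closed thompson_gen_closed)
    show ?thesis unfolding eq
      by (intro generate.eng generate.inv generate.incl 0 less.IH j)
  qed
qed

lemma thompson_generated:
  assumes "p \<ge> 2"
  shows "generate (thompson_group p) (thompson_gens p) = carrier (thompson_group p)"
proof
  interpret G: group "thompson_group p" by (rule group_thompson_group)
  show "generate (thompson_group p) (thompson_gens p) \<subseteq> carrier (thompson_group p)"
    using thompson_gens_closed by (rule G.generate_incl)
  have sub: "subgroup (generate (thompson_group p) (thompson_gens p)) (thompson_group p)"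
    using thompson_gens_closed by (rule G.generate_is_subgroup)
  have "pres_class (thompson_rels p) w \<in> generate (thompson_group p) (thompson_gens p)" for w
  proof (induction w)
    case Nil
    show ?case
      using generate.one[of "thompson_group p"]
      by (simp add: thompson_group_def one_presented_group)
  next
    case (Cons c w)
    obtain a b where c: "c = (a, b)" by fastforce
    have letter: "pres_class (thompson_rels p) [c] \<in> generate (thompson_group p) (thompson_gens p)"
    proof (cases b)
      case True
      then show ?thesis
        using thompson_gen_in_generate[OF assms, of a] c by (simp add: thompson_gen_def)
    next
      case False
      have "pres_class (thompson_rels p) [c] \<otimes>\<^bsub>thompson_group p\<^esub> thompson_gen p a
          = \<one>\<^bsub>thompson_group p\<^esub>"
        using pres_eq.cancel[of "thompson_rels p" "[]" a False "[]"] c False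
        by (simp add: thompson_gen_def thompson_group_def mult_presented_group
            one_presented_group pres_class_eq_iff)
      then have "pres_class (thompson_rels p) [c] = inv\<^bsub>thompson_group p\<^esub> thompson_gen p a"
        using G.inv_equality[of "pres_class (thompson_rels p) [c]" "thompson_gen p a"]
          thompson_gen_closed[of p a]
        by (simp add: thompson_group_def carrier_presented_group)
      then show ?thesis
        using subgroup.m_inv_closed[OF sub thompson_gen_in_generate[OF assms, of a]] by simp
    qed
    have "pres_class (thompson_rels p) (c # w) =
        pres_class (thompson_rels p) [c] \<otimes>\<^bsub>thompson_group p\<^esub> pres_class (thompson_rels p) w"
      by (simp add: thompson_group_def mult_presented_group)
    then show ?case using letter Cons by (simp add: generate.eng)
  qed
  then show "carrier (thompson_group p) \<subseteq> generate (thompson_group p) (thompson_gens p)"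
    by (auto simp: thompson_group_def carrier_presented_group)
qed

lemma list_prod_append:
  assumes "group G" "set gs \<subseteq> carrier G" "set hs \<subseteq> carrier G"
  shows "list_prod G gs \<in> carrier G \<and>
    list_prod G (gs @ hs) = list_prod G gs \<otimes>\<^bsub>G\<^esub> list_prod G hs"
proof -
  interpret G: group G by fact
  have hs: "list_prod G hs \<in> carrier G"
    using assms(3) by (induction hs) (auto simp: list_prod_def)
  show ?thesis
    using assms(2)
  proof (induction gs)
    case Nil
    then show ?case using hs by (simp add: list_prod_def)
  next
    case (Cons a gs)
    then show ?case using hs by (simp add: list_prod_def G.m_assoc)
  qed
qed

lemma generate_list_prod:
  assumes "group G" "S \<subseteq> carrier G" "g \<in> generate G S"
  shows "\<exists>gs. set gs \<subseteq> S \<union> m_inv G ` S \<and> list_prod G gs = g"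
proof -
  interpret G: group G by fact
  show ?thesis
    using assms(3)
  proof (induction rule: generate.induct)
    case one
    show ?case by (rule exI[of _ "[]"]) (simp add: list_prod_def)
  next
    case (incl h)
    then show ?case using assms(2) by (intro exI[of _ "[h]"]) (auto simp: list_prod_def)
  next
    case (inv h)
    then show ?case
      using assms(2) by (intro exI[of _ "[inv\<^bsub>G\<^esub> h]"]) (auto simp: list_prod_def)
  next
    case (eng h1 h2)
    then obtain gs hs where
      "set gs \<subseteq> S \<union> m_inv G ` S" "list_prod G gs = h1"
      "set hs \<subseteq> S \<union> m_inv G ` S" "list_prod G hs = h2" by blast
    moreover have "S \<union> m_inv G ` S \<subseteq> carrier G" using assms(2) by auto
    ultimately show ?case
      using list_prod_append[OF assms(1), of gs hs]
      by (intro exI[of _ "gs @ hs"]) auto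
  qed
qed

lemma word_ball_eq:
  assumes "group G" "S \<subseteq> carrier G" "generate G S = carrier G"
  shows "word_ball G S n =
    {list_prod G gs | gs. set gs \<subseteq> S \<union> m_inv G ` S \<and> length gs \<le> n}"
proof (intro equalityI subsetI)
  fix g assume "g \<in> word_ball G S n"
  then have g: "g \<in> generate G S" and le: "word_length G S g \<le> n"
    using assms(3) by (auto simp: word_ball_def)
  have ex: "\<exists>k gs. set gs \<subseteq> S \<union> m_inv G ` S \<and> length gs = k \<and> list_prod G gs = g"
    using generate_list_prod[OF assms(1,2) g] by blast
  show "g \<in> {list_prod G gs | gs. set gs \<subseteq> S \<union> m_inv G ` S \<and> length gs \<le> n}"
    using LeastI_ex[OF ex] le unfolding word_length_def by auto
next
  fix g assume "g \<in> {list_prod G gs | gs. set gs \<subseteq> S \<union> m_inv G ` S \<and> length gs \<le> n}"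
  then obtain gs where gs: "set gs \<subseteq> S \<union> m_inv G ` S" "length gs \<le> n" "g = list_prod G gs"
    by blast
  interpret G: group G by fact
  have "set gs \<subseteq> carrier G" using gs(1) assms(2) by auto
  then have "g \<in> carrier G" using list_prod_append[OF assms(1), of gs "[]"] gs(3) by simp
  moreover have "word_length G S g \<le> length gs"
    unfolding word_length_def by (rule Least_le) (use gs in blast)
  ultimately show "g \<in> word_ball G S n" using gs(2) by (simp add: word_ball_def)
qed

lemma finite_word_ball_thompson:
  assumes "p \<ge> 2"
  shows "finite (word_ball (thompson_group p) (thompson_gens p) n)"
proof -
  let ?A = "thompson_gens p \<union> m_inv (thompson_group p) ` thompson_gens p"
  have "finite {gs. set gs \<subseteq> ?A \<and> length gs \<le> n}"
    by (rule finite_lists_length_le) (simp add: thompson_gens_def)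
  then have "finite (list_prod (thompson_group p) ` {gs. set gs \<subseteq> ?A \<and> length gs \<le> n})"
    by (rule finite_imageI)
  moreover have "word_ball (thompson_group p) (thompson_gens p) n =
      list_prod (thompson_group p) ` {gs. set gs \<subseteq> ?A \<and> length gs \<le> n}"
    using word_ball_eq[OF group_thompson_group thompson_gens_closed thompson_generated[OF assms], of n]
    by auto
  ultimately show ?thesis by simp
qed

end

theory Submission
  imports Defs "HOL-Real_Asymp.Real_Asymp"
begin

text \<open>Positive elements are \<open>p\<close>-ary forests, and left multiplication by \<open>x\<^sub>0\<close> moves a pointer
  across \<open>p - 1\<close> trees while \<open>x\<^sub>1, ..., x\<^sub>p\<^sub>-\<^sub>1\<close> attach carets at the pointer. The cost of a forest
  (carets plus pointer moves) bounds the word length below: writing the element of an arbitrary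
  word as \<open>P Q\<^sup>-\<^sup>1\<close> with \<open>P, Q\<close> positive, each letter raises \<open>cost P - |Q|\<close> by at most one, while
  \<open>cost (g Q) \<ge> cost g + |Q|\<close> for positive \<open>g\<close>. Forests entirely to the left of the pointer attain
  the bound, and they are sequences of rows, so their generating function is
  \<open>1 / (1 - z P(z))\<close> where \<open>P\<close> counts rows. The recursion for rows makes \<open>z P(z) = 1\<close> equivalent to
  \<open>(1 - z\<^sup>2)\<^sup>p\<^sup>-\<^sup>1 (1 + z - z\<^sup>2) = 1\<close>, the stated equation for \<open>y = 1 / z\<close>; the other forests
  contribute only a polynomial factor.\<close>

section \<open>The characteristic equation\<close>

text \<open>Rewriting with the defining relations produces only equalities. That different forests
  are different elements, and that a common factor may be cancelled, is read off from a model: every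
  generator acts on the real line as an increasing piecewise linear bijection, and the shape of a
  forest can be recovered from its map.

  Fractions are carried along because suffixes of an arbitrary word for a positive element need not
  be positive. The cost 2 of a round trip is the conjugation x_0^(-1) w x_0, which raises all
  indices of w by p - 1.

  The equation in z = 1 / y holds trivially at z = 0, so a root has to be selected; the condition
  \<open>z * real p < 1\<close> does this, and every root 0 < z satisfying it has 1 / z as the
  growth rate. Uniqueness of the limit thus replaces any discussion of uniqueness of the root.

  For y = p + c the logarithm of the left-hand side is (c - 1/2) / y^2 up to order 1 / y^3. This is
  the origin of 1/2, and the reason why the sign at c = 1/2 is delicate.\<close>

lemma ln_ge_two_mult_div:
  assumes "0 \<le> (x::real)"
  shows "2 * x / (2 + x) \<le> ln (1 + x)"
proof -
  have "ln (1 + 0) - 2 * 0 / (2 + 0) \<le> ln (1 + x) - 2 * x / (2 + x)"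
  proof (rule DERIV_nonneg_imp_nondecreasing[OF assms])
    fix t :: real assume t: "0 \<le> t"
    have "((\<lambda>t. ln (1 + t) - 2 * t / (2 + t)) has_real_derivative
        1 / (1 + t) - (2 * (2 + t) - 2 * t) / ((2 + t) * (2 + t))) (at t)"
      using t by (auto intro!: derivative_eq_intros)
    moreover have "1 / (1 + t) - (2 * (2 + t) - 2 * t) / ((2 + t) * (2 + t))
        = t\<^sup>2 / ((1 + t) * (2 + t)\<^sup>2)"
      using t by (simp add: divide_simps power2_eq_square) (simp add: algebra_simps)
    ultimately show "\<exists>y. ((\<lambda>t. ln (1 + t) - 2 * t / (2 + t)) has_real_derivative y) (at t) \<and> 0 \<le> y"
      using t by auto
  qed
  then show ?thesis by simp
qed

lemma ln_one_minus_ge: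
  assumes "0 \<le> (w::real)" "w < 1"
  shows "- (w * (2 - w) / (2 * (1 - w))) \<le> ln (1 - w)"
proof -
  have "ln (1 - 0) + 0 * (2 - 0) / (2 * (1 - 0)) \<le> ln (1 - w) + w * (2 - w) / (2 * (1 - w))"
  proof (rule DERIV_nonneg_imp_nondecreasing[OF assms(1)])
    fix t :: real assume t: "0 \<le> t" "t \<le> w"
    have "((\<lambda>t. ln (1 - t) + t * (2 - t) / (2 * (1 - t))) has_real_derivative
        - 1 / (1 - t) + ((2 - 2 * t) * (2 * (1 - t)) + 2 * (t * (2 - t))) / ((2 * (1 - t)) * (2 * (1 - t)))) (at t)"
      using t assms by (auto intro!: derivative_eq_intros) (simp add: algebra_simps)?
    moreover have "- 1 / (1 - t) + ((2 - 2 * t) * (2 * (1 - t)) + 2 * (t * (2 - t))) / ((2 * (1 - t)) * (2 * (1 - t)))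
        = t\<^sup>2 / (2 * (1 - t)\<^sup>2)"
      using t assms by (simp add: divide_simps power2_eq_square) (simp add: algebra_simps)
    ultimately show "\<exists>y. ((\<lambda>t. ln (1 - t) + t * (2 - t) / (2 * (1 - t))) has_real_derivative y) (at t) \<and> 0 \<le> y"
      by auto
  qed
  then show ?thesis by simp
qed

lemma square_less_self:
  assumes "0 < (z::real)" "z < 1"
  shows "0 < z\<^sup>2" "z\<^sup>2 < z" "z\<^sup>2 < 1"
proof -
  show "z\<^sup>2 < z" using mult_strict_left_mono[OF assms(2,1)] by (simp add: power2_eq_square)
  then show "z\<^sup>2 < 1" using assms by linarith
qed (use assms in simp)

text \<open>The stated equation divided by y^(2p), with z = 1 / y; it becomes
  \<open>charfun p z = 1\<close>.\<close>

definition charfun :: "nat \<Rightarrow> real \<Rightarrow> real" where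
  "charfun p z = (1 - z\<^sup>2) ^ (p - 1) * (1 + z - z\<^sup>2)"

lemma charfun_eq_exp:
  assumes "0 < z" "z < 1" "1 \<le> p"
  shows "charfun p z = exp ((real p - 1) * ln (1 - z\<^sup>2) + ln (1 + z - z\<^sup>2))"
proof -
  note zz = square_less_self[OF assms(1,2)]
  then show ?thesis
    using assms by (simp add: charfun_def exp_add flip: of_nat_diff powr_realpow add: powr_def)
qed

text \<open>At z = 1 / p one has z - z^2 = (p - 1) z^2, so by Bernoulli the second factor is at most
  (1 + z^2)^(p - 1) and the product at most (1 - z^4)^(p - 1).\<close>

lemma charfun_at_p:
  assumes "2 \<le> p"
  shows "charfun p (1 / real p) < 1"
proof -
  define z where "z = 1 / real p"
  have z: "0 < z" "z \<le> 1 / 2" "z * real p = 1" using assms by (auto simp: z_def field_simps)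
  have zz: "0 < z\<^sup>2" "z\<^sup>2 < 1" "z\<^sup>2 < z"
    using square_less_self[of z] z by auto
  have "real (p - 1) * z\<^sup>2 = (z * real p) * z - z\<^sup>2"
    using assms by (simp add: of_nat_diff power2_eq_square algebra_simps)
  then have "1 + z - z\<^sup>2 = 1 + real (p - 1) * z\<^sup>2" using z by simp
  also have "\<dots> \<le> (1 + z\<^sup>2) ^ (p - 1)" by (rule Bernoulli_inequality) (use zz in linarith)
  finally have bern: "1 + z - z\<^sup>2 \<le> (1 + z\<^sup>2) ^ (p - 1)" .
  have "charfun p z \<le> (1 - z\<^sup>2) ^ (p - 1) * (1 + z\<^sup>2) ^ (p - 1)"
    unfolding charfun_def by (rule mult_left_mono[OF bern]) (use zz in simp)
  also have "\<dots> = ((1 - z\<^sup>2) * (1 + z\<^sup>2)) ^ (p - 1)" by (simp only: power_mult_distrib)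
  also have "(1 - z\<^sup>2) * (1 + z\<^sup>2) = 1 - z\<^sup>2 * z\<^sup>2" by (simp add: algebra_simps)
  also have "(1 - z\<^sup>2 * z\<^sup>2) ^ (p - 1) < 1"
  proof -
    have "0 < z\<^sup>2 * z\<^sup>2" "z\<^sup>2 * z\<^sup>2 < 1 * 1" using zz by (simp, intro mult_strict_mono) auto
    then show ?thesis using power_strict_mono[of "1 - z\<^sup>2 * z\<^sup>2" 1 "p - 1"] assms by simp
  qed
  finally show ?thesis by (simp add: z_def)
qed

text \<open>The terms of order z and z^2 in the logarithm cancel here and the sign is decided by 5/6
  z^3. Both logarithms are therefore replaced by rational lower bounds that are exact to second
  order.\<close>

lemma charfun_at_p_half:
  assumes "2 \<le> p"
  shows "1 < charfun p (1 / (real p + 1 / 2))"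
proof -
  define z where "z = 1 / (real p + 1 / 2)"
  have z: "0 < z" "z \<le> 2 / 5" "real p = 1 / z - 1 / 2" using assms by (auto simp: z_def field_simps)
  have zz: "0 < z\<^sup>2" "z\<^sup>2 < 1" "z\<^sup>2 < z"
    using square_less_self[of z] z by auto
  \<comment> \<open>What remains of the comparison of the two rational bounds once a factor z is
    removed and the denominators are cleared.\<close>
  have poly: "(2 - 3 * z) * (2 - z\<^sup>2) * (2 + z - z\<^sup>2) < 8 * (1 - z) * (1 - z\<^sup>2)"
  proof -
    have "8 * (1 - z) * (1 - z\<^sup>2) - (2 - 3 * z) * (2 - z\<^sup>2) * (2 + z - z\<^sup>2)
        = z\<^sup>2 * (6 - 2 * z - 5 * z\<^sup>2 + 3 * (z * z\<^sup>2))"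
      by (simp add: power2_eq_square algebra_simps)
    also have "\<dots> > 0"
    proof -
      have "5 * z\<^sup>2 < 5 * z" using zz by simp
      moreover have "0 < z * z\<^sup>2" using z(1) zz(1) by (rule mult_pos_pos)
      ultimately have "0 < 6 - 2 * z - 5 * z\<^sup>2 + 3 * (z * z\<^sup>2)" using z by linarith
      then show ?thesis using zz by simp
    qed
    finally show ?thesis by simp
  qed
  have p1: "(real p - 1) * z\<^sup>2 = z * (2 - 3 * z) / 2"
  proof -
    have zp: "z * real p = 1 - z / 2" unfolding z(3) using z(1) by (simp add: algebra_simps)
    have "(real p - 1) * z\<^sup>2 = (z * real p) * z - z\<^sup>2"
      by (simp add: power2_eq_square algebra_simps)
    also have "\<dots> = z * (2 - 3 * z) / 2"
      unfolding zp by (simp add: power2_eq_square algebra_simps)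
    finally show ?thesis .
  qed
  have "(real p - 1) * (z\<^sup>2 * (2 - z\<^sup>2) / (2 * (1 - z\<^sup>2)))
      = ((real p - 1) * z\<^sup>2) * ((2 - z\<^sup>2) / (2 * (1 - z\<^sup>2)))" by simp
  also have "\<dots> = z * (2 - 3 * z) * (2 - z\<^sup>2) / (4 * (1 - z\<^sup>2))" unfolding p1 by simp
  also have "\<dots> < 2 * (z - z\<^sup>2) / (2 + (z - z\<^sup>2))"
  proof -
    have "(z * (2 - 3 * z) * (2 - z\<^sup>2)) * (2 + (z - z\<^sup>2)) = z * ((2 - 3 * z) * (2 - z\<^sup>2) * (2 + z - z\<^sup>2))"
      by (simp add: algebra_simps)
    also have "\<dots> < z * (8 * (1 - z) * (1 - z\<^sup>2))" using poly z(1) by (rule mult_strict_left_mono)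
    also have "\<dots> = 2 * (z - z\<^sup>2) * (4 * (1 - z\<^sup>2))" by (simp add: power2_eq_square algebra_simps)
    finally show ?thesis using zz by (simp add: divide_less_eq less_divide_eq mult_ac)
  qed
  also have "\<dots> \<le> ln (1 + (z - z\<^sup>2))" using zz by (intro ln_ge_two_mult_div) auto
  finally have "(real p - 1) * (z\<^sup>2 * (2 - z\<^sup>2) / (2 * (1 - z\<^sup>2))) < ln (1 + z - z\<^sup>2)"
    by (simp add: add_diff_eq)
  moreover have "(real p - 1) * - (z\<^sup>2 * (2 - z\<^sup>2) / (2 * (1 - z\<^sup>2))) \<le> (real p - 1) * ln (1 - z\<^sup>2)"
    using assms zz by (intro mult_left_mono ln_one_minus_ge) auto
  ultimately have "0 < (real p - 1) * ln (1 - z\<^sup>2) + ln (1 + z - z\<^sup>2)" by simp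
  then show ?thesis
    using charfun_eq_exp[of z p] z assms by (simp flip: z_def)
qed

text \<open>At y = p + 1/2 - c / p the logarithm is (5/6 - c) z^3 to leading order, so c = 1 makes
  it negative for large p.\<close>

lemma eventually_charfun_less_1:
  "eventually (\<lambda>p. charfun p (1 / (real p + 1 / 2 - 1 / real p)) < 1) sequentially"
proof -
  have "eventually (\<lambda>x::real. (x - 1) * ln (1 - (1 / (x + 1 / 2 - 1 / x))\<^sup>2)
      + ln (1 + 1 / (x + 1 / 2 - 1 / x) - (1 / (x + 1 / 2 - 1 / x))\<^sup>2) < 0) at_top"
    by real_asymp
  then have "eventually (\<lambda>p. (real p - 1) * ln (1 - (1 / (real p + 1 / 2 - 1 / real p))\<^sup>2)
      + ln (1 + 1 / (real p + 1 / 2 - 1 / real p) - (1 / (real p + 1 / 2 - 1 / real p))\<^sup>2) < 0) sequentially"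
    by (rule eventually_compose_filterlim[OF _ filterlim_real_sequentially])
  then show ?thesis
    using eventually_ge_at_top[of 2]
  proof eventually_elim
    case (elim p)
    have "1 / real p \<le> 1 / 2" using elim by simp
    then have "1 < real p + 1 / 2 - 1 / real p" using elim by linarith
    then show ?case
      using elim charfun_eq_exp[of "1 / (real p + 1 / 2 - 1 / real p)" p] by simp
  qed
qed

section \<open>Rows and the cost of a forest\<close>

lemma sum_lists_length_Suc:
  assumes "finite B"
  shows "(\<Sum>xs | set xs \<subseteq> B \<and> length xs = Suc k. g xs)
    = (\<Sum>x\<in>B. \<Sum>xs | set xs \<subseteq> B \<and> length xs = k. g (x # xs))"
proof -
  have eq: "{xs. set xs \<subseteq> B \<and> length xs = Suc k}
      = (\<lambda>(x, xs). x # xs) ` (B \<times> {xs. set xs \<subseteq> B \<and> length xs = k})"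
    by (auto simp: length_Suc_conv)
  show ?thesis
    unfolding eq by (subst sum.reindex) (auto simp: inj_on_def sum.cartesian_product case_prod_unfold)
qed

text \<open>A row is the sequence of \<open>p - 1\<close> trees of a \<open>p\<close>-ary forest with root numbers \<open>1, ..., p - 1\<close>.
  In \<open>Caret i X Y\<close> the last nontrivial tree is number \<open>i\<close>; the trees before it together with
  the first \<open>p - i\<close> children of its root make up the row \<open>X\<close>, and the other \<open>i\<close> children
  form \<open>Y\<close>, which lies in the next row and therefore costs a round trip unless it is trivial.\<close>

datatype row = Triv | Caret nat row row

fun top_index :: "row \<Rightarrow> nat" where
  "top_index Triv = 0"
| "top_index (Caret i X Y) = i"

fun cost :: "row \<Rightarrow> nat" where
  "cost Triv = 0"
| "cost (Caret i X Y) = 1 + cost X + cost Y + (if Y = Triv then 0 else 2)"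

fun carets :: "row \<Rightarrow> nat" where
  "carets Triv = 0"
| "carets (Caret i X Y) = 1 + carets X + carets Y"

text \<open>The effect of x_r on two adjacent rows: the new caret takes the last p - r trees of
  \<open>X\<close> and the first r trees of \<open>Y\<close>. Trees of \<open>Y\<close> beyond r
  move into the first row and keep their number there, so a top index m > r stays on top and the
  caret descends into \<open>A\<close>.\<close>

fun join :: "nat \<Rightarrow> row \<Rightarrow> row \<Rightarrow> row" where
  "join r X Triv = Caret r X Triv"
| "join r X (Caret m A B) = (if m \<le> r then Caret r X (Caret m A B) else Caret m (join r X A) B)"

text \<open>A positive element is a pair of lists of rows, the rows to the right and to the left of a
  pointer, both starting at the pointer. The pointer moves by \<open>x\<^sub>0\<close>, so a row on the left is
  passed once and a row on the right twice.\<close>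

definition rcons :: "row \<Rightarrow> row list \<Rightarrow> row list" where
  "rcons X Rs = (if X = Triv \<and> Rs = [] then [] else X # Rs)"

fun trimmed :: "row list \<Rightarrow> bool" where
  "trimmed [] = True"
| "trimmed (X # Rs) = (trimmed Rs \<and> (Rs = [] \<longrightarrow> X \<noteq> Triv))"

fun right_cost :: "row list \<Rightarrow> nat" where
  "right_cost [] = 0"
| "right_cost (X # Rs) = cost X + (if Rs = [] then 0 else 2 + right_cost Rs)"

fun left_cost :: "row list \<Rightarrow> nat" where
  "left_cost [] = 0"
| "left_cost (X # Ss) = Suc (cost X + left_cost Ss)"

lemma left_cost_append [simp]: "left_cost (Ss @ Ts) = left_cost Ss + left_cost Ts"
  by (induction Ss) auto

lemma trimmed_rcons [simp]: "trimmed (rcons X Rs) = trimmed Rs"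
  by (auto simp: rcons_def)

lemma right_cost_rcons:
  "right_cost (rcons X Rs) = cost X + (if Rs = [] then 0 else 2 + right_cost Rs)"
  by (auto simp: rcons_def)

lemma rcons_eq_Nil [simp]: "rcons X Rs = [] \<longleftrightarrow> X = Triv \<and> Rs = []"
  by (auto simp: rcons_def)

lemma rcons_inject: "rcons X Rs = rcons Y Ts \<longleftrightarrow> X = Y \<and> Rs = Ts"
  by (auto simp: rcons_def split: if_splits)

lemma trimmed_obtain_rcons:
  assumes "trimmed Rs"
  obtains X Ts where "Rs = rcons X Ts" "trimmed Ts"
proof (cases Rs)
  case Nil
  then show ?thesis using that[of Triv "[]"] by (simp add: rcons_def)
next
  case (Cons X Ts)
  with assms show ?thesis by (intro that[of X Ts]) (auto simp: rcons_def)
qed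

text \<open>The extra 2 arises only for nontrivial \<open>Y\<close>, and then two separate
  right-hand rows have already paid 2 for the step between them. Hence both joining and splitting
  change the total cost of a state by at most 1 upwards.\<close>

lemma cost_join:
  "cost (join r X Y) = cost X + cost Y + 1 \<or>
   (Y \<noteq> Triv \<and> cost (join r X Y) = cost X + cost Y + 3)"
  by (induction r X Y rule: join.induct) auto

definition positive_word :: "nat list \<Rightarrow> nat gword" where
  "positive_word w = map (\<lambda>i. (i, True)) w"

lemma positive_word_simps [simp]:
  "positive_word [] = []"
  "positive_word (i # w) = (i, True) # positive_word w"
  "positive_word (u @ v) = positive_word u @ positive_word v"
  by (auto simp: positive_word_def)

section \<open>Positive words and the normal form of a row\<close>

locale thompson =
  fixes p :: nat
  assumes p_ge_2: "2 \<le> p"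
begin

text \<open>Equality in the monoid with the same presentation; all normal form computations stay
  free of inverses and are carried over to the group and to the action afterwards.\<close>

inductive meq :: "nat list \<Rightarrow> nat list \<Rightarrow> bool" (infix "\<approx>" 50) where
  refl [simp, intro]: "u \<approx> u"
| sym: "u \<approx> v \<Longrightarrow> v \<approx> u"
| trans [trans]: "u \<approx> v \<Longrightarrow> v \<approx> w \<Longrightarrow> u \<approx> w"
| relation: "i < j \<Longrightarrow> u @ [j, i] @ v \<approx> u @ [i, j + (p - 1)] @ v"

lemma meq_append_left: "u \<approx> v \<Longrightarrow> w @ u \<approx> w @ v"
proof (induction rule: meq.induct)
  case (relation i j u v)
  then show ?case using meq.relation[of i j "w @ u" v] by simp
qed (blast intro: meq.intros)+

lemma meq_append_right: "u \<approx> v \<Longrightarrow> u @ w \<approx> v @ w"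
proof (induction rule: meq.induct)
  case (relation i j u v)
  then show ?case using meq.relation[of i j u "v @ w"] by simp
qed (blast intro: meq.intros)+

lemma meq_append: "u \<approx> u' \<Longrightarrow> v \<approx> v' \<Longrightarrow> u @ v \<approx> u' @ v'"
  by (meson meq.trans meq_append_left meq_append_right)

lemma meq_Cons: "u \<approx> v \<Longrightarrow> i # u \<approx> i # v"
  using meq_append_left[of u v "[i]"] by simp

lemma meq_swap: "i < j \<Longrightarrow> j # i # w \<approx> i # (j + (p - 1)) # w"
  using meq.relation[of i j "[]" w] by simp

text \<open>On words in letters at least 1 this is conjugation by x_0: w x_0 = x_0 sh(w), an
  instance of the next pull rule.\<close>

definition sh :: "nat list \<Rightarrow> nat list" where
  "sh w = map (\<lambda>i. i + (p - 1)) w"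

lemma sh_simps [simp]:
  "sh [] = []" "sh (i # w) = (i + (p - 1)) # sh w" "sh (u @ v) = sh u @ sh v"
  "set (sh w) = (\<lambda>i. i + (p - 1)) ` set w" "length (sh w) = length w"
  by (auto simp: sh_def)

lemma meq_sh: "u \<approx> v \<Longrightarrow> sh u \<approx> sh v"
proof (induction rule: meq.induct)
  case (relation i j u v)
  then show ?case using meq.relation[of "i + (p - 1)" "j + (p - 1)" "sh u" "sh v"] by simp
qed (blast intro: meq.intros)+

lemma meq_pull:
  assumes "\<And>j. j \<in> set w \<Longrightarrow> i < j"
  shows "w @ i # v \<approx> i # sh w @ v"
  using assms
proof (induction w)
  case (Cons j w)
  have "j # w @ i # v \<approx> j # i # sh w @ v"
    using Cons by (intro meq_Cons) auto
  also have "\<dots> \<approx> i # (j + (p - 1)) # sh w @ v"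
    using Cons by (intro meq_swap) auto
  finally show ?case by simp
qed simp

fun wf_row :: "row \<Rightarrow> bool" where
  "wf_row Triv = True"
| "wf_row (Caret i X Y) = (1 \<le> i \<and> i < p \<and> wf_row X \<and> wf_row Y \<and> top_index Y \<le> i)"

fun wd :: "row \<Rightarrow> nat list" where
  "wd Triv = []"
| "wd (Caret i X Y) = i # sh (wd Y) @ wd X"

lemma length_wd: "length (wd X) = carets X"
  by (induction X) auto

lemma wd_pos: "wf_row X \<Longrightarrow> j \<in> set (wd X) \<Longrightarrow> 1 \<le> j"
  by (induction X arbitrary: j) fastforce+

lemma top_index_less: "wf_row X \<Longrightarrow> top_index X < p"
  using p_ge_2 by (cases X) auto

text \<open>Beyond the top index the trees are trivial, so root j is also a leaf, namely number j +
  (p - 1) * carets. A caret placed at that root or at that leaf is the same caret.\<close>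

lemma meq_push_row:
  assumes "wf_row X" "top_index X < j"
  shows "j # wd X \<approx> wd X @ [j + (p - 1) * carets X]"
  using assms
proof (induction X arbitrary: j)
  case (Caret i X Y)
  let ?y = "j + (p - 1) * carets Y"
  have "j # i # sh (wd Y) @ wd X \<approx> i # (j + (p - 1)) # sh (wd Y) @ wd X"
    using Caret.prems by (intro meq_swap) auto
  also have "\<dots> = [i] @ sh (j # wd Y) @ wd X" by simp
  also have "\<dots> \<approx> [i] @ sh (wd Y @ [?y]) @ wd X"
    using Caret by (intro meq_append meq_sh) auto
  also have "\<dots> = ([i] @ sh (wd Y)) @ ((?y + (p - 1)) # wd X)" by simp
  also have "\<dots> \<approx> ([i] @ sh (wd Y)) @ (wd X @ [(?y + (p - 1)) + (p - 1) * carets X])"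
    using Caret.prems top_index_less[of X] p_ge_2
    by (intro meq_append_left Caret.IH(1)) auto
  finally show ?case by (simp add: algebra_simps)
qed simp

lemma meq_pass_row:
  assumes "wf_row X" "1 \<le> l"
  shows "wd X @ [l + (p - 1) + (p - 1) * carets X] \<approx> (l + (p - 1)) # wd X"
  using assms top_index_less[of X] by (intro meq.sym[OF meq_push_row]) auto

lemma wf_row_join:
  assumes "wf_row X" "wf_row Y" "1 \<le> r" "r < p"
  shows "wf_row (join r X Y)"
  using assms by (induction r X Y rule: join.induct) auto

lemma wd_join:
  assumes "wf_row Y" "1 \<le> r"
  shows "r # sh (wd Y) @ wd X \<approx> wd (join r X Y)"
  using assms
proof (induction r X Y rule: join.induct)
  case (2 r X m A B)
  show ?case
  proof (cases "m \<le> r")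
    case False
    have "r # sh (wd (Caret m A B)) @ wd X
        = [] @ [r, m + (p - 1)] @ sh (sh (wd B) @ wd A) @ wd X" by simp
    also have "\<dots> \<approx> [] @ [m, r] @ sh (sh (wd B) @ wd A) @ wd X"
      using False by (intro meq.sym[OF meq.relation]) simp
    also have "\<dots> = [m] @ (r # sh (sh (wd B)) @ sh (wd A) @ wd X)" by simp
    also have "\<dots> \<approx> [m] @ (sh (wd B) @ r # sh (wd A) @ wd X)"
      using False 2 wd_pos[of B]
      by (intro meq_append_left meq.sym[OF meq_pull]) (fastforce)
    also have "\<dots> \<approx> [m] @ (sh (wd B) @ wd (join r X A))"
      using False 2 by (intro meq_append_left) auto
    finally show ?thesis using False by simp
  qed simp
qed simp

text \<open>Either tree r carries a caret at its root, which is removed, or it is a single leaf,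
  which is split first by one letter k on the right. For r below the top index m the search
  continues in \<open>A\<close>, and the top caret returns to the second row as
  \<open>Caret m Y B\<close>.\<close>

lemma unjoin:
  assumes "wf_row Z" "1 \<le> r" "r < p"
  shows "\<exists>X Y. wf_row X \<and> wf_row Y \<and>
    (Z = join r X Y \<or>
     cost X + cost Y \<le> cost Z \<and> (\<exists>k\<ge>1. wd Z @ [k] \<approx> r # sh (wd Y) @ wd X))"
  using assms
proof (induction Z)
  case Triv
  then show ?case by (intro exI[of _ Triv]) (auto intro!: exI[of _ r])
next
  case (Caret m A B)
  consider "r < m" | "r = m" | "m < r" by linarith
  then show ?case
  proof cases
    case 1
    then obtain X Y where XY: "wf_row X" "wf_row Y"
      and *: "A = join r X Y \<or>
        cost X + cost Y \<le> cost A \<and> (\<exists>k\<ge>1. wd A @ [k] \<approx> r # sh (wd Y) @ wd X)"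
      using Caret by auto
    from * show ?thesis
    proof
      assume "A = join r X Y"
      then show ?thesis
        using 1 XY Caret.prems by (intro exI[of _ X] exI[of _ "Caret m Y B"]) auto
    next
      assume "cost X + cost Y \<le> cost A \<and> (\<exists>k\<ge>1. wd A @ [k] \<approx> r # sh (wd Y) @ wd X)"
      then obtain k where le: "cost X + cost Y \<le> cost A"
        and k: "k \<ge> 1" "wd A @ [k] \<approx> r # sh (wd Y) @ wd X" by blast
      have "wd (Caret m A B) @ [k] = (m # sh (wd B)) @ (wd A @ [k])" by simp
      also have "\<dots> \<approx> (m # sh (wd B)) @ (r # sh (wd Y) @ wd X)"
        using k(2) by (rule meq_append_left)
      also have "\<dots> \<approx> r # sh (m # sh (wd B)) @ (sh (wd Y) @ wd X)"
        using 1 Caret.prems wd_pos[of B] by (intro meq_pull) fastforce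
      finally have "wd (Caret m A B) @ [k] \<approx> r # sh (wd (Caret m Y B)) @ wd X" by simp
      then show ?thesis
        using 1 XY le k(1) Caret.prems
        by (intro exI[of _ X] exI[of _ "Caret m Y B"]) auto
    qed
  next
    case 2
    then have "Caret m A B = join r A B" using Caret.prems by (cases B) auto
    moreover have "wf_row A" "wf_row B" using Caret.prems by auto
    ultimately show ?thesis by blast
  next
    case 3
    let ?Z = "Caret m A B"
    have "wd ?Z @ [r + (p - 1) * carets ?Z] \<approx> r # sh (wd Triv) @ wd ?Z"
      using meq.sym[OF meq_push_row[of ?Z r]] 3 Caret.prems by simp
    then show ?thesis
      using Caret.prems by (intro exI[of _ ?Z] exI[of _ Triv]) (auto intro!: exI[of _ "r + (p - 1) * carets ?Z"])
  qed
qed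

text \<open>A letter on the right puts a caret on leaf k. In \<open>Caret m A B\<close> the leaves
  come in three blocks: those of the p - 1 trees of \<open>A\<close> (counted by \<open>?a\<close>),
  those of the m trees of \<open>B\<close>, and the trivial trees m + 1, ..., t. No caret is lost
  and no round trip disappears, so the cost grows.\<close>

lemma row_right_mult:
  assumes "wf_row X" "top_index X \<le> t" "t < p" "1 \<le> k" "k \<le> t + (p - 1) * carets X"
  shows "\<exists>Z. wf_row Z \<and> top_index Z \<le> t \<and> wd X @ [k] \<approx> wd Z \<and> cost X + 1 \<le> cost Z"
  using assms
proof (induction X arbitrary: t k)
  case Triv
  then show ?case by (intro exI[of _ "Caret k Triv Triv"]) auto
next
  case (Caret m A B)
  let ?a = "(p - 1) + (p - 1) * carets A"
  consider "k \<le> ?a" | "?a < k" "k \<le> ?a + m + (p - 1) * carets B"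
    | "?a + m + (p - 1) * carets B < k" by linarith
  then show ?case
  proof cases
    case 1
    then obtain Z where "wf_row Z" "wd A @ [k] \<approx> wd Z" "cost A + 1 \<le> cost Z"
      using Caret.IH(1)[of "p - 1" k] Caret.prems top_index_less[of A] by fastforce
    moreover from this(2) have "wd (Caret m A B) @ [k] \<approx> wd (Caret m Z B)"
      using meq_append_left[of "wd A @ [k]" "wd Z" "m # sh (wd B)"] by simp
    ultimately show ?thesis
      using Caret.prems by (intro exI[of _ "Caret m Z B"]) auto
  next
    case 2
    define l where "l = k - ?a"
    have l: "1 \<le> l" "l \<le> m + (p - 1) * carets B" "k = l + (p - 1) + (p - 1) * carets A"
      using 2 by (auto simp: l_def)
    then obtain Z where Z: "wf_row Z" "top_index Z \<le> m" "wd B @ [l] \<approx> wd Z" "cost B + 1 \<le> cost Z"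
      using Caret.IH(2)[of m l] Caret.prems by fastforce
    have "wd (Caret m A B) @ [k] = ([m] @ sh (wd B)) @ (wd A @ [k])" by simp
    also have "\<dots> \<approx> ([m] @ sh (wd B)) @ ((l + (p - 1)) # wd A)"
      unfolding l(3) using l Caret.prems by (intro meq_append_left meq_pass_row) auto
    also have "\<dots> = [m] @ sh (wd B @ [l]) @ wd A" by simp
    also have "\<dots> \<approx> [m] @ sh (wd Z) @ wd A"
      using Z(3) by (intro meq_append_left meq_append_right meq_sh)
    finally have "wd (Caret m A B) @ [k] \<approx> wd (Caret m A Z)" by simp
    then show ?thesis
      using Caret.prems Z by (intro exI[of _ "Caret m A Z"]) auto
  next
    case 3
    let ?X = "Caret m A B"
    define j where "j = k - (p - 1) * carets ?X"
    have "(p - 1) * carets ?X = (p - 1) + (p - 1) * carets A + (p - 1) * carets B"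
      by (simp add: distrib_left)
    then have j: "m < j" "j \<le> t" "k = j + (p - 1) * carets ?X"
      using 3 Caret.prems(5) unfolding j_def by linarith+
    have "wd ?X @ [k] \<approx> wd (Caret j ?X Triv)"
      using meq.sym[OF meq_push_row[of ?X j]] j Caret.prems by simp
    then show ?thesis
      using Caret.prems j by (intro exI[of _ "Caret j ?X Triv"]) auto
  qed
qed

section \<open>Positive elements as rows on both sides of a pointer\<close>

fun right_word :: "row list \<Rightarrow> nat list" where
  "right_word [] = []"
| "right_word (X # Rs) = sh (right_word Rs) @ wd X"

fun left_word :: "row list \<Rightarrow> nat list" where
  "left_word [] = []"
| "left_word (X # Ss) = 0 # wd X @ left_word Ss"

definition wf_rows :: "row list \<Rightarrow> bool" where
  "wf_rows Rs = (\<forall>X\<in>set Rs. wf_row X)"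

lemma wf_rows_simps [simp]:
  "wf_rows []" "wf_rows (X # Rs) \<longleftrightarrow> wf_row X \<and> wf_rows Rs"
  "wf_rows (Rs @ Ts) \<longleftrightarrow> wf_rows Rs \<and> wf_rows Ts"
  "wf_rows (rcons X Rs) \<longleftrightarrow> wf_row X \<and> wf_rows Rs"
  by (auto simp: wf_rows_def rcons_def)

lemma left_word_append [simp]: "left_word (Ss @ Ts) = left_word Ss @ left_word Ts"
  by (induction Ss) auto

lemma right_word_rcons [simp]: "right_word (rcons X Rs) = sh (right_word Rs) @ wd X"
  by (auto simp: rcons_def)

lemma right_word_pos: "wf_rows Rs \<Longrightarrow> j \<in> set (right_word Rs) \<Longrightarrow> 1 \<le> j"
  using p_ge_2 by (induction Rs arbitrary: j) (auto dest: wd_pos)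

lemma wf_trimmed_obtain_rcons:
  assumes "trimmed Rs" "wf_rows Rs"
  obtains X Ts where "Rs = rcons X Ts" "trimmed Ts" "wf_row X" "wf_rows Ts"
  using trimmed_obtain_rcons[OF assms(1)] assms(2)
  by (metis wf_rows_simps(4))

lemma right_rows_right_mult:
  assumes "trimmed Rs" "wf_rows Rs" "1 \<le> k"
  shows "\<exists>Ts. trimmed Ts \<and> wf_rows Ts \<and> right_word Rs @ [k] \<approx> right_word Ts \<and>
    right_cost Rs + 1 \<le> right_cost Ts"
  using assms
proof (induction k arbitrary: Rs rule: less_induct)
  case (less k)
  obtain X Us where Rs: "Rs = rcons X Us" "trimmed Us" "wf_row X" "wf_rows Us"
    using wf_trimmed_obtain_rcons less.prems by metis
  show ?case
  proof (cases "k \<le> (p - 1) + (p - 1) * carets X")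
    case True
    then obtain Z where Z: "wf_row Z" "wd X @ [k] \<approx> wd Z" "cost X + 1 \<le> cost Z"
      using row_right_mult[of X "p - 1" k] Rs top_index_less[of X] less.prems by fastforce
    from Z(2) have "right_word Rs @ [k] \<approx> right_word (rcons Z Us)"
      using meq_append_left[of "wd X @ [k]" "wd Z" "sh (right_word Us)"] Rs by simp
    then show ?thesis
      using Rs Z by (intro exI[of _ "rcons Z Us"]) (auto simp: right_cost_rcons)
  next
    case False
    define l where "l = k - ((p - 1) + (p - 1) * carets X)"
    have l: "1 \<le> l" "l < k" "k = l + (p - 1) + (p - 1) * carets X"
      using False p_ge_2 by (auto simp: l_def)
    obtain Ts where Ts: "trimmed Ts" "wf_rows Ts" "right_word Us @ [l] \<approx> right_word Ts"
      "right_cost Us + 1 \<le> right_cost Ts"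
      using less.IH[OF l(2) Rs(2,4) l(1)] by blast
    have "right_word Rs @ [k] = sh (right_word Us) @ (wd X @ [k])" by (simp add: Rs)
    also have "\<dots> \<approx> sh (right_word Us) @ ((l + (p - 1)) # wd X)"
      unfolding l(3) using l Rs by (intro meq_append_left meq_pass_row) auto
    also have "\<dots> = sh (right_word Us @ [l]) @ wd X" by simp
    also have "\<dots> \<approx> sh (right_word Ts) @ wd X"
      using Ts(3) by (intro meq_append_right meq_sh)
    finally have "right_word Rs @ [k] \<approx> right_word (rcons X Ts)" by simp
    moreover have "Ts \<noteq> []" using Ts(4) by auto
    ultimately show ?thesis
      using Rs Ts by (intro exI[of _ "rcons X Ts"]) (auto simp: right_cost_rcons)
  qed
qed

text \<open>On the right x_0 adds a trivial row at the far end of the left part. Leaves are counted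
  from that end, so other letters pass the left rows from the last one inwards, by x_0 x_(l+p-1) =
  x_l x_0; this dictates the reversed induction.\<close>

lemma state_right_mult:
  assumes "trimmed Rs" "wf_rows Rs" "wf_rows Ss"
  shows "\<exists>Rs' Ss'. trimmed Rs' \<and> wf_rows Rs' \<and> wf_rows Ss' \<and>
    right_word Rs @ left_word Ss @ [k] \<approx> right_word Rs' @ left_word Ss' \<and>
    right_cost Rs + left_cost Ss + 1 \<le> right_cost Rs' + left_cost Ss'"
proof (cases "k = 0")
  case True
  then show ?thesis
    using assms by (intro exI[of _ Rs] exI[of _ "Ss @ [Triv]"]) auto
next
  case False
  then have "1 \<le> k" by simp
  with assms show ?thesis
  proof (induction Ss arbitrary: k rule: rev_induct)
    case Nil
    then show ?case using right_rows_right_mult[of Rs k]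
      by (metis append_Nil append_Nil2 left_cost.simps(1) left_word.simps(1) add.right_neutral)
  next
    case (snoc S Ss)
    show ?case
    proof (cases "k \<le> (p - 1) + (p - 1) * carets S")
      case True
      then obtain Z where Z: "wf_row Z" "wd S @ [k] \<approx> wd Z" "cost S + 1 \<le> cost Z"
        using row_right_mult[of S "p - 1" k] snoc.prems top_index_less[of S] by fastforce
      from Z(2) have "right_word Rs @ left_word (Ss @ [S]) @ [k] \<approx> right_word Rs @ left_word (Ss @ [Z])"
        using meq_append_left[of "wd S @ [k]" "wd Z" "right_word Rs @ left_word Ss @ [0]"] by simp
      then show ?thesis
        using snoc.prems Z by (intro exI[of _ Rs] exI[of _ "Ss @ [Z]"]) auto
    next
      case False
      define l where "l = k - ((p - 1) + (p - 1) * carets S)"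
      have l: "1 \<le> l" "k = l + (p - 1) + (p - 1) * carets S"
        using False p_ge_2 by (auto simp: l_def)
      obtain Rs' Ss' where IH: "trimmed Rs'" "wf_rows Rs'" "wf_rows Ss'"
        "right_word Rs @ left_word Ss @ [l] \<approx> right_word Rs' @ left_word Ss'"
        "right_cost Rs + left_cost Ss + 1 \<le> right_cost Rs' + left_cost Ss'"
        using snoc.IH[of l] snoc.prems l by fastforce
      have "right_word Rs @ left_word (Ss @ [S]) @ [k]
          = (right_word Rs @ left_word Ss @ [0]) @ (wd S @ [k])" by simp
      also have "\<dots> \<approx> (right_word Rs @ left_word Ss @ [0]) @ ((l + (p - 1)) # wd S)"
        unfolding l(2) using l snoc.prems by (intro meq_append_left meq_pass_row) auto
      also have "\<dots> = (right_word Rs @ left_word Ss) @ [0, l + (p - 1)] @ wd S" by simp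
      also have "\<dots> \<approx> (right_word Rs @ left_word Ss) @ [l, 0] @ wd S"
        using l by (intro meq.sym[OF meq.relation]) simp
      also have "\<dots> = (right_word Rs @ left_word Ss @ [l]) @ (0 # wd S)" by simp
      also have "\<dots> \<approx> (right_word Rs' @ left_word Ss') @ (0 # wd S)"
        using IH(4) by (rule meq_append_right)
      finally have "right_word Rs @ left_word (Ss @ [S]) @ [k]
          \<approx> right_word Rs' @ left_word (Ss' @ [S])" by simp
      then show ?thesis
        using IH snoc.prems by (intro exI[of _ Rs'] exI[of _ "Ss' @ [S]"]) auto
    qed
  qed
qed

lemma state_right_mult_word:
  assumes "trimmed Rs" "wf_rows Rs" "wf_rows Ss"
  shows "\<exists>Rs' Ss'. trimmed Rs' \<and> wf_rows Rs' \<and> wf_rows Ss' \<and>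
    right_word Rs @ left_word Ss @ q \<approx> right_word Rs' @ left_word Ss' \<and>
    right_cost Rs + left_cost Ss + length q \<le> right_cost Rs' + left_cost Ss'"
  using assms
proof (induction q arbitrary: Rs Ss)
  case Nil
  then show ?case by auto
next
  case (Cons k q)
  obtain Rs1 Ss1 where 1: "trimmed Rs1" "wf_rows Rs1" "wf_rows Ss1"
    "right_word Rs @ left_word Ss @ [k] \<approx> right_word Rs1 @ left_word Ss1"
    "right_cost Rs + left_cost Ss + 1 \<le> right_cost Rs1 + left_cost Ss1"
    using state_right_mult[OF Cons.prems] by blast
  obtain Rs2 Ss2 where 2: "trimmed Rs2" "wf_rows Rs2" "wf_rows Ss2"
    "right_word Rs1 @ left_word Ss1 @ q \<approx> right_word Rs2 @ left_word Ss2"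
    "right_cost Rs1 + left_cost Ss1 + length q \<le> right_cost Rs2 + left_cost Ss2"
    using Cons.IH[OF 1(1-3)] by blast
  have "right_word Rs @ left_word Ss @ k # q = (right_word Rs @ left_word Ss @ [k]) @ q" by simp
  also have "\<dots> \<approx> (right_word Rs1 @ left_word Ss1) @ q"
    using 1(4) by (rule meq_append_right)
  also have "\<dots> = right_word Rs1 @ left_word Ss1 @ q" by simp
  also note 2(4)
  finally show ?case using 1 2
    by (intro exI[of _ Rs2] exI[of _ Ss2]) auto
qed

text \<open>x_0 moves one row from right to left: its passage costs 1 on the left, and the right
  side never becomes dearer. Any other generator joins the two rows next to the pointer.\<close>

lemma state_left_mult:
  assumes "trimmed Rs" "wf_rows Rs" "wf_rows Ss" "i < p"
  shows "\<exists>Rs' Ss'. trimmed Rs' \<and> wf_rows Rs' \<and> wf_rows Ss' \<and>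
    i # right_word Rs @ left_word Ss \<approx> right_word Rs' @ left_word Ss' \<and>
    right_cost Rs' + left_cost Ss' \<le> right_cost Rs + left_cost Ss + 1"
proof -
  obtain X Ts where Rs: "Rs = rcons X Ts" "trimmed Ts" "wf_row X" "wf_rows Ts"
    using wf_trimmed_obtain_rcons assms(1,2) by metis
  show ?thesis
  proof (cases "i = 0")
    case True
    have "0 # sh (right_word Ts) @ wd X @ left_word Ss \<approx> right_word Ts @ 0 # wd X @ left_word Ss"
      using right_word_pos[OF Rs(4)] by (intro meq.sym[OF meq_pull]) force
    then show ?thesis
      using Rs assms True
      by (intro exI[of _ Ts] exI[of _ "X # Ss"]) (auto simp: right_cost_rcons)
  next
    case False
    obtain Y Us where Ts: "Ts = rcons Y Us" "trimmed Us" "wf_row Y" "wf_rows Us"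
      using wf_trimmed_obtain_rcons Rs by metis
    have "i # right_word Rs @ left_word Ss
        = i # sh (sh (right_word Us)) @ (sh (wd Y) @ wd X @ left_word Ss)"
      by (simp add: Rs Ts)
    also have "\<dots> \<approx> sh (right_word Us) @ i # (sh (wd Y) @ wd X @ left_word Ss)"
      using right_word_pos[OF Ts(4)] assms(4) by (intro meq.sym[OF meq_pull]) fastforce
    also have "\<dots> = sh (right_word Us) @ (i # sh (wd Y) @ wd X) @ left_word Ss" by simp
    also have "\<dots> \<approx> sh (right_word Us) @ wd (join i X Y) @ left_word Ss"
      using False Ts by (intro meq_append_left meq_append_right wd_join) auto
    finally have "i # right_word Rs @ left_word Ss
        \<approx> right_word (rcons (join i X Y) Us) @ left_word Ss" by simp
    moreover have "right_cost (rcons (join i X Y) Us) \<le> right_cost Rs + 1"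
      using cost_join[of i X Y] by (auto simp: Rs Ts right_cost_rcons)
    ultimately show ?thesis
      using False Rs Ts assms wf_row_join
      by (intro exI[of _ "rcons (join i X Y) Us"] exI[of _ Ss]) auto
  qed
qed

lemma meq_push_left_word:
  assumes "wf_rows Ss" "1 \<le> k"
  shows "\<exists>l. k # left_word Ss \<approx> left_word Ss @ [l]"
  using assms
proof (induction Ss arbitrary: k)
  case (Cons S Ss)
  let ?m = "k + (p - 1) + (p - 1) * carets S"
  obtain l where l: "?m # left_word Ss \<approx> left_word Ss @ [l]"
    using Cons.IH[of ?m] Cons.prems by auto
  have "k # left_word (S # Ss) \<approx> 0 # (k + (p - 1)) # wd S @ left_word Ss"
    using Cons.prems meq_swap[of 0 k] by simp
  also have "\<dots> = [0] @ ((k + (p - 1)) # wd S) @ left_word Ss" by simp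
  also have "\<dots> \<approx> [0] @ (wd S @ [?m]) @ left_word Ss"
    using Cons.prems top_index_less[of S]
    by (intro meq_append_left meq_append_right meq_push_row) auto
  also have "\<dots> = (0 # wd S) @ (?m # left_word Ss)" by simp
  also have "\<dots> \<approx> (0 # wd S) @ (left_word Ss @ [l])"
    using l by (rule meq_append_left)
  finally show ?case by auto
qed auto

text \<open>Division by x_i may first require a right multiple, and each letter of \<open>q\<close>
  pays for one further unit of cost. At most one letter occurs: x_0 when no row is left of the
  pointer, or a split leaf supplied by \<open>unjoin\<close>.\<close>

lemma state_left_div:
  assumes "trimmed Rs" "wf_rows Rs" "wf_rows Ss" "i < p"
  shows "\<exists>Rs' Ss' q. trimmed Rs' \<and> wf_rows Rs' \<and> wf_rows Ss' \<and>
    right_word Rs @ left_word Ss @ q \<approx> i # right_word Rs' @ left_word Ss' \<and>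
    right_cost Rs' + left_cost Ss' \<le> right_cost Rs + left_cost Ss + 1 + length q"
proof (cases "i = 0")
  case True
  show ?thesis
  proof (cases Ss)
    case Nil
    have "right_word Rs @ [0] \<approx> 0 # sh (right_word Rs) @ []"
      using right_word_pos[OF assms(2)] by (intro meq_pull) force
    then show ?thesis
      using Nil assms True
      by (intro exI[of _ "rcons Triv Rs"] exI[of _ "[]"] exI[of _ "[0]"])
        (auto simp: right_cost_rcons)
  next
    case (Cons S Ts)
    have "right_word Rs @ 0 # wd S @ left_word Ts \<approx> 0 # sh (right_word Rs) @ wd S @ left_word Ts"
      using right_word_pos[OF assms(2)] by (intro meq_pull) force
    then show ?thesis
      using Cons assms True
      by (intro exI[of _ "rcons S Rs"] exI[of _ Ts] exI[of _ "[]"])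
        (auto simp: right_cost_rcons)
  qed
next
  case False
  obtain Z Ts where Rs: "Rs = rcons Z Ts" "trimmed Ts" "wf_row Z" "wf_rows Ts"
    using wf_trimmed_obtain_rcons assms(1,2) by metis
  obtain X Y where XY: "wf_row X" "wf_row Y"
    and *: "Z = join i X Y \<or>
        cost X + cost Y \<le> cost Z \<and> (\<exists>k\<ge>1. wd Z @ [k] \<approx> i # sh (wd Y) @ wd X)"
    using unjoin[of Z i] Rs False assms by auto
  let ?Rs' = "rcons X (rcons Y Ts)"
  have wf': "trimmed ?Rs'" "wf_rows ?Rs'" using Rs XY by auto
  have pull: "sh (right_word Ts) @ (i # sh (wd Y) @ wd X) @ left_word Ss
      \<approx> i # right_word ?Rs' @ left_word Ss"
    using meq_pull[of "sh (right_word Ts)" i "sh (wd Y) @ wd X @ left_word Ss"]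
      right_word_pos[OF Rs(4)] assms(4) by fastforce
  from * show ?thesis
  proof
    assume Z: "Z = join i X Y"
    have "right_word Rs @ left_word Ss = sh (right_word Ts) @ wd (join i X Y) @ left_word Ss"
      by (simp add: Rs Z)
    also have "\<dots> \<approx> sh (right_word Ts) @ (i # sh (wd Y) @ wd X) @ left_word Ss"
      using XY False by (intro meq_append_left meq_append_right meq.sym[OF wd_join]) auto
    also note pull
    finally have "right_word Rs @ left_word Ss @ [] \<approx> i # right_word ?Rs' @ left_word Ss" by simp
    moreover have "right_cost ?Rs' \<le> right_cost Rs + 1"
      using cost_join[of i X Y] by (auto simp: Rs Z right_cost_rcons)
    ultimately show ?thesis using assms wf'
      by (intro exI[of _ ?Rs'] exI[of _ Ss] exI[of _ "[]"]) auto
  next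
    assume "cost X + cost Y \<le> cost Z \<and> (\<exists>k\<ge>1. wd Z @ [k] \<approx> i # sh (wd Y) @ wd X)"
    then obtain k where le: "cost X + cost Y \<le> cost Z"
      and k: "1 \<le> k" "wd Z @ [k] \<approx> i # sh (wd Y) @ wd X" by blast
    \<comment> \<open>The leaf to be split is numbered inside the first right-hand row; the letter
      must still be moved past all left rows to stand at the end of the word.\<close>
    obtain l where l: "k # left_word Ss \<approx> left_word Ss @ [l]"
      by (rule exE[OF meq_push_left_word[OF assms(3) k(1)]])
    have "right_word Rs @ left_word Ss @ [l] \<approx> right_word Rs @ (k # left_word Ss)"
      by (rule meq_append_left[OF meq.sym[OF l]])
    also have "\<dots> = sh (right_word Ts) @ (wd Z @ [k]) @ left_word Ss" by (simp add: Rs)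
    also have "\<dots> \<approx> sh (right_word Ts) @ (i # sh (wd Y) @ wd X) @ left_word Ss"
      using k(2) by (intro meq_append_left meq_append_right)
    also note pull
    finally have "right_word Rs @ left_word Ss @ [l] \<approx> i # right_word ?Rs' @ left_word Ss" .
    moreover have "right_cost ?Rs' \<le> right_cost Rs + 2"
      using le by (auto simp: Rs right_cost_rcons)
    ultimately show ?thesis using assms wf'
      by (intro exI[of _ ?Rs'] exI[of _ Ss] exI[of _ "[l]"]) auto
  qed
qed

section \<open>The piecewise linear action\<close>

text \<open>The standard model of x_i: splitting tree i into p parts stretches its unit interval
  over p unit intervals and translates everything to the right.\<close>

definition pl :: "nat \<Rightarrow> real \<Rightarrow> real" where
  "pl i t = (if t \<le> real i then t
    else if t \<le> real i + 1 then real i + real p * (t - real i) else t + (real p - 1))"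

definition pl_inv :: "nat \<Rightarrow> real \<Rightarrow> real" where
  "pl_inv i t = (if t \<le> real i then t
    else if t \<le> real i + real p then real i + (t - real i) / real p else t - (real p - 1))"

lemma pl_inv_pl [simp]: "pl_inv i (pl i t) = t"
proof -
  consider "t \<le> i" | "i < t" "t \<le> real i + 1" | "real i + 1 < t" by linarith
  then show ?thesis
  proof cases
    case 2
    then have "0 < p * (t - i)" "real p * (t - i) \<le> real p * 1"
      using p_ge_2 by (auto intro: mult_left_mono)
    then show ?thesis using 2 by (auto simp: pl_def pl_inv_def)
  qed (use p_ge_2 in \<open>auto simp: pl_def pl_inv_def\<close>)
qed

lemma pl_pl_inv [simp]: "pl i (pl_inv i t) = t"
proof -
  consider "t \<le> i" | "i < t" "t \<le> real i + real p" | "real i + real p < t" by linarith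
  then show ?thesis
  proof cases
    case 2
    define s where "s = (t - i) / p"
    have s: "real p * s = t - i" using p_ge_2 by (simp add: s_def)
    have "0 < real p * s" "real p * s \<le> real p * 1" using 2 s by auto
    then have "0 < s" "s \<le> 1"
      using p_ge_2 by (simp_all only: zero_less_mult_iff mult_le_cancel_left) auto
    moreover have "pl_inv i t = i + s" using 2 by (auto simp: pl_inv_def s_def)
    ultimately show ?thesis using s by (simp add: pl_def)
  qed (use p_ge_2 in \<open>auto simp: pl_def pl_inv_def\<close>)
qed

text \<open>All slopes are at least 1. This yields injectivity, and it prevents later letters from
  undoing a displacement.\<close>

lemma pl_expanding: "s \<le> t \<Longrightarrow> t - s \<le> pl i t - pl i s"
proof -
  assume st: "s \<le> t"
  define d where "d = real p - 1"
  have d: "1 \<le> d" "real p = d + 1" using p_ge_2 by (auto simp: d_def of_nat_diff)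
  have e: "pl i t = t + d * max 0 (min 1 (t - i))" for t
    by (auto simp: pl_def d max_def min_def algebra_simps)
  have "max 0 (min 1 (s - i)) \<le> max 0 (min 1 (t - i))" using st by auto
  then have "d * max 0 (min 1 (s - i)) \<le> d * max 0 (min 1 (t - i))"
    using d by (intro mult_left_mono) auto
  then show ?thesis by (simp add: e)
qed

lemma pl_le: "pl i t \<le> t + (real p - 1)"
proof -
  consider "t \<le> i" | "i < t" "t \<le> real i + 1" | "real i + 1 < t" by linarith
  then show ?thesis
  proof cases
    case 2
    have "(real p - 1) * (t - i) \<le> (real p - 1) * 1"
      using 2 p_ge_2 by (intro mult_left_mono) auto
    then show ?thesis using 2 p_ge_2 by (simp add: pl_def of_nat_diff algebra_simps)
  qed (use p_ge_2 in \<open>auto simp: pl_def of_nat_diff\<close>)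
qed

lemma pl_relation: "i < j \<Longrightarrow> pl i (pl j t) = pl (j + (p - 1)) (pl i t)"
proof -
  assume ij: "i < j"
  then have ij': "real i + 1 \<le> real j" by linarith
  have d: "real (j + (p - 1)) = real j + real p - 1" "real (p - 1) = real p - 1"
    using p_ge_2 by (auto simp: of_nat_diff)
  consider "t \<le> i" | "i < t" "t \<le> real i + 1" | "real i + 1 < t" by linarith
  then show ?thesis
  proof cases
    case 1
    then show ?thesis using ij' p_ge_2 by (simp add: pl_def)
  next
    case 2
    have "real p * (t - i) \<le> real p * 1" using 2 by (intro mult_left_mono) auto
    then have "pl i t \<le> real j + real p - 1" using 2 ij' by (simp add: pl_def)
    then have "pl (j + (p - 1)) (pl i t) = pl i t" by (simp only: pl_def d if_True)
    then show ?thesis using 2 ij' by (simp add: pl_def)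
  next
    case 3
    have "t \<le> pl j t" using pl_expanding[of j t j] p_ge_2
      by (cases "t \<le> j") (auto simp: pl_def of_nat_diff)
    then have "pl i (pl j t) = pl j t + (real p - 1)" using 3 by (simp add: pl_def)
    moreover have "pl (j + (p - 1)) (t + (real p - 1)) = pl j t + (real p - 1)"
      unfolding pl_def d by (auto simp: algebra_simps)
    ultimately show ?thesis using 3 by (simp add: pl_def)
  qed
qed

lemma pl_shift: "pl (i + (p - 1)) (t + (real p - 1)) = pl i t + (real p - 1)"
proof -
  have d: "real (i + (p - 1)) = real i + real p - 1" "real (p - 1) = real p - 1"
    using p_ge_2 by (auto simp: of_nat_diff)
  show ?thesis unfolding pl_def d by (auto simp: algebra_simps)
qed

text \<open>A right action: the first letter is applied first, so the action respects concatenation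
  in the order of the group product.\<close>

primrec act :: "nat gword \<Rightarrow> real \<Rightarrow> real" where
  "act [] t = t"
| "act (c # w) t = act w (if snd c then pl (fst c) t else pl_inv (fst c) t)"

lemma act_append: "act (u @ v) t = act v (act u t)"
  by (induction u arbitrary: t) auto

lemma act_pres_eq: "pres_eq (thompson_rels p) u v \<Longrightarrow> act u t = act v t"
proof (induction arbitrary: t rule: pres_eq.induct)
  case (cancel u a b v)
  show ?case by (cases b) (auto simp: act_append)
next
  case (relation l r u v)
  then obtain i j where "l = [(j, True), (i, True)]" "r = [(i, True), (j + (p - 1), True)]" "i < j"
    using p_ge_2 by (auto simp: thompson_rels_def)
  then show ?case using pl_relation[of i j] by (simp add: act_append)
qed auto

abbreviation flow :: "nat list \<Rightarrow> real \<Rightarrow> real" where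
  "flow w \<equiv> act (positive_word w)"

lemma meq_imp_pres_eq: "u \<approx> v \<Longrightarrow> pres_eq (thompson_rels p) (positive_word u) (positive_word v)"
proof (induction rule: meq.induct)
  case (relation i j u v)
  then have "([(j, True), (i, True)], [(i, True), (j + (p - 1), True)]) \<in> thompson_rels p"
    using p_ge_2 by (auto simp: thompson_rels_def)
  from pres_eq.relation[OF this, of "positive_word u" "positive_word v"] show ?case by simp
qed (blast intro: pres_eq.intros)+

lemma flow_meq: "u \<approx> v \<Longrightarrow> flow u = flow v"
  using act_pres_eq meq_imp_pres_eq by blast

lemma flow_append: "flow (u @ v) t = flow v (flow u t)"
  by (simp add: act_append)

lemma flow_expanding: "s \<le> t \<Longrightarrow> t - s \<le> flow w t - flow w s"
proof (induction w arbitrary: s t)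
  case (Cons i w)
  have "t - s \<le> pl i t - pl i s" using Cons.prems by (rule pl_expanding)
  also have "\<dots> \<le> flow w (pl i t) - flow w (pl i s)"
    using Cons.prems pl_expanding[OF Cons.prems, of i] by (intro Cons.IH) auto
  finally show ?case by simp
qed simp

lemma inj_flow: "flow w s = flow w t \<longleftrightarrow> s = t"
  using flow_expanding[of s t w] flow_expanding[of t s w] by (cases "s \<le> t") auto

lemma surj_flow: "\<exists>s. flow w s = t"
proof (induction w arbitrary: t)
  case (Cons i w)
  obtain s where "flow w s = t" using Cons by blast
  then show ?case by (intro exI[of _ "pl_inv i s"]) simp
qed simp

lemma flow_cancel_left: "flow (w @ u) = flow (w @ v) \<Longrightarrow> flow u = flow v"
  using surj_flow[of w] by (metis flow_append ext)

lemma flow_cancel_right: "flow (u @ w) = flow (v @ w) \<Longrightarrow> flow u = flow v"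
  by (metis flow_append inj_flow ext)

lemma flow_le: "flow w t \<le> t + (real p - 1) * length w"
proof (induction w arbitrary: t)
  case (Cons i w)
  show ?case using Cons[of "pl i t"] pl_le[of i t] by (simp add: algebra_simps)
qed simp

lemma flow_fixes: "(\<And>i. i \<in> set w \<Longrightarrow> t \<le> real i) \<Longrightarrow> flow w t = t"
  by (induction w) (auto simp: pl_def)

lemma flow_sh: "flow (sh w) (t + (real p - 1)) = flow w t + (real p - 1)"
  by (induction w arbitrary: t) (auto simp: pl_shift simp del: of_nat_add One_nat_def)

lemma flow_sh_inject: "flow (sh u) = flow (sh v) \<Longrightarrow> flow u = flow v"
  by (metis flow_sh add_right_cancel ext)

section \<open>Recovering a forest from its map\<close>

lemma flow_wd_beyond:
  assumes "wf_row X" "real (top_index X) + 1 \<le> t"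
  shows "flow (wd X) t = t + (real p - 1) * carets X"
  using assms
proof (induction X arbitrary: t)
  case (Caret i X Y)
  have Y: "flow (wd Y) t = t + (real p - 1) * carets Y" using Caret by auto
  have i: "pl i t = t + (real p - 1)" using Caret.prems p_ge_2 by (auto simp: pl_def)
  let ?t = "t + (real p - 1) * carets Y + (real p - 1)"
  have "real (top_index X) + 1 \<le> ?t"
  proof -
    have "0 \<le> (real p - 1) * carets Y" using p_ge_2 by simp
    moreover have "real (top_index X) + 1 \<le> real p"
      using top_index_less[of X] Caret.prems by simp
    moreover have "1 \<le> t" using Caret.prems by simp
    ultimately show ?thesis by linarith
  qed
  then have X: "flow (wd X) ?t = ?t + (real p - 1) * carets X"
    using Caret by auto
  have "flow (wd (Caret i X Y)) t = flow (wd X) (flow (sh (wd Y)) (t + (real p - 1)))"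
    by (simp add: act_append i)
  also have "\<dots> = ?t + (real p - 1) * carets X"
    using X by (simp only: flow_sh Y)
  finally show ?case by (simp add: algebra_simps)
qed simp

lemma carets_flow:
  assumes "wf_row X" "wf_row Y" "flow (wd X) t = flow (wd Y) t" "real p \<le> t"
  shows "carets X = carets Y"
proof -
  have "real (top_index X) + 1 \<le> t" "real (top_index Y) + 1 \<le> t"
    using top_index_less[OF assms(1)] top_index_less[OF assms(2)] assms(4) by linarith+
  then have "t + (real p - 1) * carets X = t + (real p - 1) * carets Y"
    using assms(3) flow_wd_beyond[OF assms(1)] flow_wd_beyond[OF assms(2)] by simp
  then show ?thesis using p_ge_2 by simp
qed

text \<open>The point i is fixed by x_i and by all letters of \<open>sh (wd Y)\<close>, so only the
  carets of \<open>X\<close> can move it. It therefore falls short of the full translation valid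
  further right, and this gap exposes the top index.\<close>

lemma flow_wd_top:
  assumes "wf_row (Caret i X Y)"
  shows "flow (wd (Caret i X Y)) i \<le> i + (real p - 1) * carets X"
proof -
  have "flow (sh (wd Y)) i = i"
    using assms by (intro flow_fixes) auto
  then have "flow (wd (Caret i X Y)) i = flow (wd X) i" by (simp add: act_append pl_def)
  then show ?thesis using flow_le[of "wd X" i] by (simp add: length_wd)
qed

lemma top_index_flow:
  assumes "wf_row X" "wf_row Y" "flow (wd X) = flow (wd Y)"
  shows "top_index Y \<le> top_index X"
proof (rule ccontr)
  assume "\<not> ?thesis"
  then have less: "top_index X < top_index Y" by simp
  then obtain i A B where Y: "Y = Caret i A B" by (cases Y) auto
  have "carets X = carets Y"
    using carets_flow[of X Y "real p"] assms by simp
  moreover have "flow (wd X) i = i + (real p - 1) * carets X"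
    using less Y assms(1) by (intro flow_wd_beyond) auto
  moreover have "flow (wd Y) i \<le> i + (real p - 1) * carets A"
    using flow_wd_top assms(2) Y by simp
  ultimately have "(real p - 1) * carets Y \<le> (real p - 1) * carets A"
    using assms(3) by simp
  then show False using Y p_ge_2 by simp
qed

text \<open>The shifted word fixes everything up to p, so there the map is that of the row alone.
  Its value at p gives the number of carets, hence the translation beyond p; the row map is known
  everywhere and can be cancelled.\<close>

lemma flow_wd_inject_aux:
  assumes "wf_row X" "wf_row Z" "\<And>i. i \<in> set u \<Longrightarrow> 1 \<le> i" "\<And>i. i \<in> set v \<Longrightarrow> 1 \<le> i"
    and eq: "flow (sh u @ wd X) = flow (sh v @ wd Z)"
  shows "flow (wd X) = flow (wd Z)" "flow u = flow v"
proof -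
  have fix_u: "flow (sh u) t = t" if "t \<le> real p" for t
    using that assms(3) p_ge_2 by (intro flow_fixes) force
  have fix_v: "flow (sh v) t = t" if "t \<le> real p" for t
    using that assms(4) p_ge_2 by (intro flow_fixes) force
  have le: "flow (wd X) t = flow (wd Z) t" if "t \<le> real p" for t
    using fun_cong[OF eq, of t] fix_u[OF that] fix_v[OF that] by (simp add: act_append)
  have c: "carets X = carets Z"
    using carets_flow[of X Z "real p"] le[of "real p"] assms by simp
  have XZ: "flow (wd X) t = flow (wd Z) t" for t
  proof (cases "t \<le> real p")
    case False
    then have "real (top_index X) + 1 \<le> t" "real (top_index Z) + 1 \<le> t"
      using top_index_less[OF assms(1)] top_index_less[OF assms(2)] by linarith+
    then show ?thesis using flow_wd_beyond assms c by simp
  qed (use le in simp)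
  then show "flow (wd X) = flow (wd Z)" by blast
  have "flow (sh v @ wd Z) = flow (sh v @ wd X)"
    by (rule ext) (simp only: flow_append XZ)
  from eq this have "flow (sh u @ wd X) = flow (sh v @ wd X)" by (rule HOL.trans)
  then have "flow (sh u) = flow (sh v)" by (rule flow_cancel_right)
  then show "flow u = flow v" by (rule flow_sh_inject)
qed

lemma flow_wd_inject:
  assumes "wf_row X" "wf_row Z" "flow (wd X) = flow (wd Z)"
  shows "X = Z"
  using assms
proof (induction X arbitrary: Z)
  case Triv
  have "top_index Z = 0" using top_index_flow[OF Triv.prems] by simp
  then show ?case using Triv by (cases Z) auto
next
  case (Caret i A B)
  have "top_index Z = i"
    using top_index_flow[OF Caret.prems]
      top_index_flow[OF Caret.prems(2,1) Caret.prems(3)[symmetric]] by simp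
  then obtain C D where Z: "Z = Caret i C D" using Caret.prems by (cases Z) auto
  have "flow ([i] @ sh (wd B) @ wd A) = flow ([i] @ sh (wd D) @ wd C)"
    using Caret.prems(3) unfolding Z by (simp only: wd.simps append_Cons append_Nil)
  then have "flow (sh (wd B) @ wd A) = flow (sh (wd D) @ wd C)"
    by (rule flow_cancel_left)
  then have "flow (wd A) = flow (wd C)" "flow (wd B) = flow (wd D)"
    using flow_wd_inject_aux[of A C "wd B" "wd D"] Caret.prems Z wd_pos by auto
  then show ?case using Caret Z by auto
qed

lemma flow_right_word_inject:
  assumes "trimmed Rs" "wf_rows Rs" "trimmed Ts" "wf_rows Ts"
    "flow (right_word Rs) = flow (right_word Ts)"
  shows "Rs = Ts"
  using assms
proof (induction "length Rs + length Ts" arbitrary: Rs Ts rule: less_induct)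
  case less
  show ?case
  proof (cases "Rs = [] \<and> Ts = []")
    case False
    define hd' where "hd' Us = (if Us = [] then Triv else hd Us)" for Us
    have R: "Us = rcons (hd' Us) (tl Us)" if "trimmed Us" for Us
      using that by (cases Us) (auto simp: hd'_def rcons_def)
    have T: "trimmed (tl Us)" if "trimmed Us" for Us using that by (cases Us) auto
    have W: "wf_row (hd' Us)" "wf_rows (tl Us)" if "wf_rows Us" for Us
      using that by (cases Us; auto simp: hd'_def)+
    have "flow (sh (right_word (tl Rs)) @ wd (hd' Rs)) = flow (sh (right_word (tl Ts)) @ wd (hd' Ts))"
      using less.prems R[of Rs] R[of Ts] by (metis right_word_rcons)
    then have "flow (wd (hd' Rs)) = flow (wd (hd' Ts))"
      and tl: "flow (right_word (tl Rs)) = flow (right_word (tl Ts))"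
      using flow_wd_inject_aux[of "hd' Rs" "hd' Ts" "right_word (tl Rs)" "right_word (tl Ts)"]
        less.prems W right_word_pos by blast+
    then have "hd' Rs = hd' Ts" using flow_wd_inject W less.prems by blast
    moreover have "tl Rs = tl Ts"
      using less.prems T W tl False by (intro less.hyps) (auto simp flip: length_greater_0_conv)
    ultimately show ?thesis using R[of Rs] R[of Ts] less.prems by metis
  qed simp
qed

text \<open>Right rows fix the point 1, whereas the x_0 of a left row sends it to p, and expansion
  keeps it at p or above.\<close>

lemma flow_state_at_1:
  assumes "wf_rows Rs"
  shows "flow (right_word Rs @ left_word Ss) 1 = 1 \<longleftrightarrow> Ss = []"
proof -
  have 1: "flow (right_word Rs) 1 = 1"
    using right_word_pos[OF assms] by (intro flow_fixes) force
  show ?thesis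
  proof (cases Ss)
    case (Cons S Ts)
    have "flow (wd S @ left_word Ts) 0 = 0" by (intro flow_fixes) auto
    then have "real p \<le> flow (wd S @ left_word Ts) (real p)"
      using flow_expanding[of 0 "real p" "wd S @ left_word Ts"] by simp
    moreover have "pl 0 1 = real p" by (simp add: pl_def)
    ultimately show ?thesis using 1 Cons p_ge_2 by (simp add: act_append)
  qed (use 1 in simp)
qed

text \<open>If both left parts are nonempty, x_0 can be pulled to the front and cancelled, which
  returns a left row to the right side; \<open>rcons\<close> remains injective in this
  process.\<close>

lemma flow_state_inject:
  assumes "trimmed Rs" "wf_rows Rs" "wf_rows Ss" "trimmed Rs'" "wf_rows Rs'" "wf_rows Ss'"
    "flow (right_word Rs @ left_word Ss) = flow (right_word Rs' @ left_word Ss')"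
  shows "Rs = Rs' \<and> Ss = Ss'"
  using assms
proof (induction Ss arbitrary: Ss' Rs Rs')
  case Nil
  then have "Ss' = []" using flow_state_at_1[of Rs "[]"] flow_state_at_1[of Rs' Ss'] by simp
  then show ?case using Nil flow_right_word_inject[of Rs Rs'] by simp
next
  case (Cons S Ss)
  then have "Ss' \<noteq> []" using flow_state_at_1[of Rs "S # Ss"] flow_state_at_1[of Rs' Ss'] by auto
  then obtain S' Ts where Ss': "Ss' = S' # Ts" by (cases Ss') auto
  have move: "flow (right_word Us @ left_word (U # Vs)) = flow ([0] @ right_word (rcons U Us) @ left_word Vs)"
    if "wf_rows Us" for U Us Vs
    using meq_pull[of "right_word Us" 0 "wd U @ left_word Vs"] right_word_pos[OF that]
    by (intro flow_meq) force
  have "flow ([0] @ right_word (rcons S Rs) @ left_word Ss)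
      = flow ([0] @ right_word (rcons S' Rs') @ left_word Ts)"
    using Cons.prems move Ss' by metis
  then have "flow (right_word (rcons S Rs) @ left_word Ss) = flow (right_word (rcons S' Rs') @ left_word Ts)"
    by (rule flow_cancel_left)
  then have "rcons S Rs = rcons S' Rs' \<and> Ss = Ts"
    using Cons.prems Ss' by (intro Cons.IH) auto
  then show ?case using Ss' by (simp add: rcons_inject)
qed

section \<open>Word length against cost\<close>

text \<open>The positive word \<open>q\<close> clears the denominator of the element represented by \<open>W\<close>. Splitting
  a leaf raises the cost by at most 2, but it also lengthens \<open>q\<close>, so \<open>cost - length q\<close> grows by
  at most 1 per letter.\<close>

lemma gword_state:
  assumes "fst ` set W \<subseteq> {..<p}"
  shows "\<exists>Rs Ss q. trimmed Rs \<and> wf_rows Rs \<and> wf_rows Ss \<and>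
    act (W @ positive_word q) = flow (right_word Rs @ left_word Ss) \<and>
    right_cost Rs + left_cost Ss \<le> length W + length q"
  using assms
proof (induction W)
  case Nil
  show ?case by (intro exI[of _ "[]"]) auto
next
  case (Cons c W)
  then obtain Rs Ss q where IH: "trimmed Rs" "wf_rows Rs" "wf_rows Ss"
    "act (W @ positive_word q) = flow (right_word Rs @ left_word Ss)"
    "right_cost Rs + left_cost Ss \<le> length W + length q" by auto
  obtain i b where c: "c = (i, b)" by fastforce
  have i: "i < p" using Cons.prems c by simp
  show ?case
  proof (cases b)
    case True
    obtain Rs' Ss' where *: "trimmed Rs'" "wf_rows Rs'" "wf_rows Ss'"
      "i # right_word Rs @ left_word Ss \<approx> right_word Rs' @ left_word Ss'"
      "right_cost Rs' + left_cost Ss' \<le> right_cost Rs + left_cost Ss + 1"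
      using state_left_mult[OF IH(1-3) i] by blast
    have "act ((c # W) @ positive_word q) = flow (i # right_word Rs @ left_word Ss)"
      using IH(4) c True by (intro ext) simp
    also have "\<dots> = flow (right_word Rs' @ left_word Ss')" using *(4) by (rule flow_meq)
    finally show ?thesis using * IH(5)
      by (intro exI[of _ Rs'] exI[of _ Ss'] exI[of _ q]) auto
  next
    case False
    obtain Rs' Ss' r where *: "trimmed Rs'" "wf_rows Rs'" "wf_rows Ss'"
      "right_word Rs @ left_word Ss @ r \<approx> i # right_word Rs' @ left_word Ss'"
      "right_cost Rs' + left_cost Ss' \<le> right_cost Rs + left_cost Ss + 1 + length r"
      using state_left_div[OF IH(1-3) i] by blast
    have "act ((c # W) @ positive_word (q @ r)) t = flow (right_word Rs' @ left_word Ss') t" for t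
    proof -
      have "act ((c # W) @ positive_word (q @ r)) t
          = flow r (act (W @ positive_word q) (pl_inv i t))"
        using c False by (simp add: act_append)
      also have "\<dots> = flow (right_word Rs @ left_word Ss @ r) (pl_inv i t)"
        by (simp only: IH(4)) (simp add: act_append)
      also have "\<dots> = flow (i # right_word Rs' @ left_word Ss') (pl_inv i t)"
        by (simp only: flow_meq[OF *(4)])
      finally show ?thesis by simp
    qed
    then show ?thesis using * IH(5)
      by (intro exI[of _ Rs'] exI[of _ Ss'] exI[of _ "q @ r"]) auto
  qed
qed

text \<open>Two normal forms of the same product u q are compared: the one obtained from the word
  costs at most |W| + |q|, the one obtained from u costs at least |q| more than the normal form of
  u. They coincide by injectivity, and |q| cancels.\<close>

lemma state_cost_le:
  assumes "fst ` set W \<subseteq> {..<p}" "pres_eq (thompson_rels p) W (positive_word u)"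
  shows "\<exists>Rs Ss. trimmed Rs \<and> wf_rows Rs \<and> wf_rows Ss \<and>
    pres_eq (thompson_rels p) W (positive_word (right_word Rs @ left_word Ss)) \<and>
    right_cost Rs + left_cost Ss \<le> length W"
proof -
  obtain Rs Ss q where 1: "trimmed Rs" "wf_rows Rs" "wf_rows Ss"
    "act (W @ positive_word q) = flow (right_word Rs @ left_word Ss)"
    "right_cost Rs + left_cost Ss \<le> length W + length q"
    using gword_state[OF assms(1)] by blast
  obtain Ru Su where 2: "trimmed Ru" "wf_rows Ru" "wf_rows Su"
    "u \<approx> right_word Ru @ left_word Su"
    using state_right_mult_word[of "[]" "[]" u] by auto
  obtain Rv Sv where 3: "trimmed Rv" "wf_rows Rv" "wf_rows Sv"
    "right_word Ru @ left_word Su @ q \<approx> right_word Rv @ left_word Sv"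
    "right_cost Ru + left_cost Su + length q \<le> right_cost Rv + left_cost Sv"
    using state_right_mult_word[OF 2(1-3), of q] by blast
  have "flow (right_word Rv @ left_word Sv) t = flow (right_word Rs @ left_word Ss) t" for t
  proof -
    have "flow (right_word Rv @ left_word Sv) t = flow (right_word Ru @ left_word Su @ q) t"
      by (simp only: flow_meq[OF 3(4)])
    also have "\<dots> = flow q (flow (right_word Ru @ left_word Su) t)" by (simp add: act_append)
    also have "\<dots> = flow q (flow u t)" by (simp only: flow_meq[OF 2(4)])
    also have "\<dots> = act (W @ positive_word q) t"
      by (simp add: act_append act_pres_eq[OF assms(2)])
    finally show ?thesis by (simp add: 1(4))
  qed
  then have "Rv = Rs \<and> Sv = Ss" using 1 3 by (intro flow_state_inject) auto
  then have "right_cost Ru + left_cost Su \<le> length W" using 1 3 by simp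
  moreover have "pres_eq (thompson_rels p) W (positive_word (right_word Ru @ left_word Su))"
    using assms(2) meq_imp_pres_eq[OF 2(4)] by (rule pres_eq.trans)
  ultimately show ?thesis using 2 by blast
qed

lemma row_short_word:
  assumes "wf_row X"
  shows "\<exists>W. fst ` set W \<subseteq> {..<p} \<and> length W = cost X \<and>
    pres_eq (thompson_rels p) W (positive_word (wd X))"
  using assms
proof (induction X)
  case Triv
  show ?case by (intro exI[of _ "[]"]) (auto intro: pres_eq.refl)
next
  case (Caret i X Y)
  obtain U V where U: "fst ` set U \<subseteq> {..<p}" "length U = cost X"
      "pres_eq (thompson_rels p) U (positive_word (wd X))"
    and V: "fst ` set V \<subseteq> {..<p}" "length V = cost Y"
      "pres_eq (thompson_rels p) V (positive_word (wd Y))"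
    using Caret by auto
  show ?case
  proof (cases "Y = Triv")
    case True
    then show ?thesis using U Caret.prems
      pres_eq_append_left[OF U(3), of "[(i, True)]"]
      by (intro exI[of _ "(i, True) # U"]) auto
  next
    case False
    let ?eq = "pres_eq (thompson_rels p)"
    note [trans] = pres_eq.trans
    \<comment> \<open>A short word for the shifted second half is a conjugate of a short word for
      \<open>Y\<close>; the two letters x_0^(-1) and x_0 are the 2 in the cost.\<close>
    have "?eq ([(0, False)] @ V @ [(0, True)]) ([(0, False)] @ positive_word (wd Y) @ [(0, True)])"
      using V(3) by (intro pres_eq_append_left pres_eq_append_right)
    also have "?eq \<dots> ([(0, False)] @ positive_word (0 # sh (wd Y)))"
    proof -
      have "wd Y @ [0] \<approx> 0 # sh (wd Y) @ []"
        using wd_pos[of Y] Caret.prems by (intro meq_pull) force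
      from meq_imp_pres_eq[OF this] show ?thesis
        by (intro pres_eq_append_left) simp
    qed
    also have "?eq \<dots> (positive_word (sh (wd Y)))"
      using pres_eq.cancel[of _ "[]" 0 False "positive_word (sh (wd Y))"] by simp
    finally have "?eq ([(i, True)] @ ([(0, False)] @ V @ [(0, True)]) @ U)
      ([(i, True)] @ positive_word (sh (wd Y)) @ positive_word (wd X))"
      using U(3) by (intro pres_eq_append_left pres_eq_append)
    then show ?thesis using U V Caret.prems False p_ge_2
      by (intro exI[of _ "[(i, True)] @ ([(0, False)] @ V @ [(0, True)]) @ U"]) auto
  qed
qed

lemma left_short_word:
  assumes "wf_rows Ss"
  shows "\<exists>W. fst ` set W \<subseteq> {..<p} \<and> length W = left_cost Ss \<and>
    pres_eq (thompson_rels p) W (positive_word (left_word Ss))"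
  using assms
proof (induction Ss)
  case Nil
  show ?case by (intro exI[of _ "[]"]) (auto intro: pres_eq.refl)
next
  case (Cons S Ss)
  obtain U where U: "fst ` set U \<subseteq> {..<p}" "length U = cost S"
      "pres_eq (thompson_rels p) U (positive_word (wd S))"
    using row_short_word[of S] Cons.prems by auto
  obtain V where V: "fst ` set V \<subseteq> {..<p}" "length V = left_cost Ss"
      "pres_eq (thompson_rels p) V (positive_word (left_word Ss))"
    using Cons by auto
  have "pres_eq (thompson_rels p) ([(0, True)] @ U @ V)
      ([(0, True)] @ positive_word (wd S) @ positive_word (left_word Ss))"
    using U(3) V(3) by (intro pres_eq_append_left pres_eq_append)
  then show ?case using U V p_ge_2
    by (intro exI[of _ "[(0, True)] @ U @ V"]) auto
qed

section \<open>Passage to classes of words and to the word ball\<close>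

lemma list_prod_positive:
  "list_prod (thompson_group p) (map (thompson_gen p) is)
    = pres_class (thompson_rels p) (positive_word is)"
  by (induction "is")
    (auto simp: list_prod_def thompson_group_def thompson_gen_def one_presented_group mult_presented_group)

lemma thompson_positive_eq:
  "thompson_positive p = range (\<lambda>is. pres_class (thompson_rels p) (positive_word is))"
  unfolding thompson_positive_def list_prod_positive by auto

definition letter :: "nat \<times> bool \<Rightarrow> nat gword set" where
  "letter c = pres_class (thompson_rels p) [c]"

lemma inv_thompson_gen:
  "inv\<^bsub>thompson_group p\<^esub> thompson_gen p i = letter (i, False)"
proof -
  interpret G: group "thompson_group p" by (rule group_thompson_group)
  have "letter (i, False) \<otimes>\<^bsub>thompson_group p\<^esub> thompson_gen p i = \<one>\<^bsub>thompson_group p\<^esub>"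
    using pres_eq.cancel[of "thompson_rels p" "[]" i False "[]"]
    by (simp add: letter_def thompson_gen_def thompson_group_def mult_presented_group
        one_presented_group pres_class_eq_iff)
  moreover have "letter (i, False) \<in> carrier (thompson_group p)"
    by (simp add: letter_def thompson_group_def carrier_presented_group)
  ultimately show ?thesis using G.inv_equality thompson_gen_closed by blast
qed

lemma letters_eq:
  "thompson_gens p \<union> m_inv (thompson_group p) ` thompson_gens p = letter ` {c. fst c < p}"
proof -
  have "{c. fst c < p} = (\<lambda>i. (i, True)) ` {0..p - 1} \<union> (\<lambda>i. (i, False)) ` {0..p - 1}"
    using p_ge_2 by (auto simp: image_iff)
  moreover have "thompson_gens p = (\<lambda>i. letter (i, True)) ` {0..p - 1}"
    by (simp add: thompson_gens_def thompson_gen_def letter_def)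
  moreover have "m_inv (thompson_group p) ` thompson_gens p = (\<lambda>i. letter (i, False)) ` {0..p - 1}"
    by (simp only: thompson_gens_def image_image inv_thompson_gen)
  ultimately show ?thesis by (simp only: image_Un image_image)
qed

lemma list_prod_letters:
  "list_prod (thompson_group p) (map letter W) = pres_class (thompson_rels p) W"
  by (induction W)
    (auto simp: list_prod_def thompson_group_def letter_def one_presented_group mult_presented_group)

lemma word_ball_thompson:
  "word_ball (thompson_group p) (thompson_gens p) n =
    {pres_class (thompson_rels p) W | W. fst ` set W \<subseteq> {..<p} \<and> length W \<le> n}"
proof -
  have "{gs. set gs \<subseteq> letter ` {c. fst c < p} \<and> length gs \<le> n}
      = map letter ` {W. fst ` set W \<subseteq> {..<p} \<and> length W \<le> n}" (is "?L = ?R")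
  proof
    show "?L \<subseteq> ?R"
    proof
      fix gs assume gs: "gs \<in> ?L"
      then have "gs \<in> lists (letter ` {c. fst c < p})" by auto
      then have "gs \<in> map letter ` lists {c. fst c < p}" by (simp only: lists_image)
      then show "gs \<in> ?R" using gs by (fastforce simp: lists_eq_set)
    qed
    show "?R \<subseteq> ?L" by (auto simp: image_subset_iff intro!: imageI)
  qed
  moreover have "{list_prod G gs | gs. set gs \<subseteq> A \<and> length gs \<le> n}
      = list_prod G ` {gs. set gs \<subseteq> A \<and> length gs \<le> n}" for G :: "nat gword set monoid" and A
    by blast
  ultimately show ?thesis
    unfolding word_ball_eq[OF group_thompson_group thompson_gens_closed thompson_generated[OF p_ge_2]]
      letters_eq
    by (simp only: image_image list_prod_letters) blast
qed

section \<open>Counting\<close>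

text \<open>Nesting depth at most d makes the sets finite, so that generating functions can be
  handled as finite sums. The index bound m has to vary, because the second component of
  \<open>Caret i X Y\<close> occupies only i trees.\<close>

primrec rows :: "nat \<Rightarrow> nat \<Rightarrow> row set" where
  "rows 0 = (\<lambda>m. {Triv})"
| "rows (Suc d) = (\<lambda>m. insert Triv
     ((\<lambda>(i, X, Y). Caret i X Y) ` (SIGMA i:{1..m}. rows d (p - 1) \<times> rows d i)))"

lemma finite_rows [simp]: "finite (rows d m)"
  by (induction d arbitrary: m) auto

lemma Triv_in_rows [simp]: "Triv \<in> rows d m"
  by (cases d) auto

lemma wf_rows_rows: "X \<in> rows d m \<Longrightarrow> m < p \<Longrightarrow> wf_row X \<and> top_index X \<le> m"
proof (induction d arbitrary: X m)
  case (Suc d)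
  then show ?case using p_ge_2 by (fastforce)
qed auto

lemma rows_mono: "rows d m \<subseteq> rows (Suc d) m"
proof (induction d arbitrary: m)
  case (Suc d)
  have "(SIGMA i:{1..m}. rows d (p - 1) \<times> rows d i)
      \<subseteq> (SIGMA i:{1..m}. rows (Suc d) (p - 1) \<times> rows (Suc d) i)"
    by (intro Sigma_mono order_refl Suc.IH)
  then show ?case by (subst (1 2) rows.simps(2)) (intro insert_mono image_mono)
qed auto

lemma in_rows: "wf_row X \<Longrightarrow> top_index X \<le> m \<Longrightarrow> carets X \<le> d \<Longrightarrow> X \<in> rows d m"
proof (induction X arbitrary: m d)
  case (Caret i X Y)
  then obtain e where d: "d = Suc e" by (cases d) auto
  have "X \<in> rows e (p - 1)" using Caret d top_index_less[of X] by auto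
  moreover have "Y \<in> rows e i" using Caret d by auto
  ultimately have "(i, X, Y) \<in> (SIGMA i:{1..m}. rows e (p - 1) \<times> rows e i)"
    using Caret.prems by auto
  then show ?case unfolding d rows.simps by (intro insertI2 image_eqI[of _ _ "(i, X, Y)"]) auto
qed auto

lemma carets_le_cost: "carets X \<le> cost X"
  by (induction X) auto

definition row_sum :: "real \<Rightarrow> nat \<Rightarrow> nat \<Rightarrow> real" where
  "row_sum z d m = (\<Sum>X\<in>rows d m. z ^ cost X)"

lemma row_sum_0 [simp]: "row_sum z 0 m = 1"
  by (simp add: row_sum_def)

lemma row_sum_Suc:
  "row_sum z (Suc d) m
    = 1 + (\<Sum>i=1..m. z * row_sum z d (p - 1) * (1 + z\<^sup>2 * (row_sum z d i - 1)))"
proof -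
  \<comment> \<open>The trivial second half has weight 1; every other one pays z^2 for its round
    trip.\<close>
  have inner: "(\<Sum>Y\<in>rows d i. z ^ (cost Y + (if Y = Triv then 0 else 2)))
      = 1 + z\<^sup>2 * (row_sum z d i - 1)" for i
  proof -
    have "(\<Sum>Y\<in>rows d i - {Triv}. z ^ (cost Y + (if Y = Triv then 0 else 2)))
        = z\<^sup>2 * (\<Sum>Y\<in>rows d i - {Triv}. z ^ cost Y)"
      unfolding sum_distrib_left by (intro sum.cong) (auto simp: power2_eq_square)
    then show ?thesis
      by (simp add: row_sum_def sum.remove[of "rows d i" Triv])
  qed
  have "(\<Sum>X\<in>(\<lambda>(i, X, Y). Caret i X Y) ` (SIGMA i:{1..m}. rows d (p - 1) \<times> rows d i). z ^ cost X)
      = (\<Sum>(i, X, Y)\<in>(SIGMA i:{1..m}. rows d (p - 1) \<times> rows d i). z ^ cost (Caret i X Y))"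
    by (subst sum.reindex) (auto simp: inj_on_def case_prod_unfold)
  also have "\<dots> = (\<Sum>i=1..m. \<Sum>(X, Y)\<in>rows d (p - 1) \<times> rows d i. z ^ cost (Caret i X Y))"
    by (subst sum.Sigma) (auto simp: case_prod_unfold)
  also have "\<dots> = (\<Sum>i=1..m. z * row_sum z d (p - 1) * (1 + z\<^sup>2 * (row_sum z d i - 1)))"
  proof (intro sum.cong HOL.refl)
    fix i
    have "(\<Sum>(X, Y)\<in>rows d (p - 1) \<times> rows d i. z ^ cost (Caret i X Y))
        = (\<Sum>X\<in>rows d (p - 1). \<Sum>Y\<in>rows d i.
            (z * z ^ cost X) * z ^ (cost Y + (if Y = Triv then 0 else 2)))"
      unfolding sum.cartesian_product by (intro sum.cong) (auto simp: power_add mult_ac)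
    also have "\<dots> = z * row_sum z d (p - 1) * (1 + z\<^sup>2 * (row_sum z d i - 1))"
      by (simp only: inner row_sum_def flip: sum_distrib_left sum_distrib_right)
    finally show "(\<Sum>(X, Y)\<in>rows d (p - 1) \<times> rows d i. z ^ cost (Caret i X Y)) = \<dots>" .
  qed
  finally show ?thesis
    unfolding row_sum_def[of z "Suc d"] rows.simps
    by (subst sum.insert) (auto intro!: finite_imageI finite_SigmaI)
qed

lemma inj_left_state:
  "inj_on (\<lambda>Ss. pres_class (thompson_rels p) (positive_word (left_word Ss))) {Ss. wf_rows Ss}"
proof (rule inj_onI)
  fix Ss Ts
  assume *: "Ss \<in> {Ss. wf_rows Ss}" "Ts \<in> {Ss. wf_rows Ss}"
    and "pres_class (thompson_rels p) (positive_word (left_word Ss))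
      = pres_class (thompson_rels p) (positive_word (left_word Ts))"
  then have "flow (left_word Ss) = flow (left_word Ts)"
    using act_pres_eq by (simp only: pres_class_eq_iff) blast
  then have "[] = ([] :: row list) \<and> Ss = Ts"
    using * by (intro flow_state_inject) auto
  then show "Ss = Ts" by simp
qed

lemma card_left_states_le_positive_count:
  assumes "\<And>Ss. Ss \<in> W \<Longrightarrow> wf_rows Ss \<and> left_cost Ss \<le> n"
  shows "card W \<le> positive_count p n"
proof -
  let ?f = "\<lambda>Ss. pres_class (thompson_rels p) (positive_word (left_word Ss))"
  have "?f Ss \<in> thompson_positive p \<inter> word_ball (thompson_group p) (thompson_gens p) n"
    if Ss: "Ss \<in> W" for Ss
  proof
    obtain V where "fst ` set V \<subseteq> {..<p}" "length V = left_cost Ss"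
      "pres_eq (thompson_rels p) V (positive_word (left_word Ss))"
      using left_short_word assms[OF Ss] by blast
    then show "?f Ss \<in> word_ball (thompson_group p) (thompson_gens p) n"
      using assms[OF Ss] unfolding word_ball_thompson
      by (auto simp flip: pres_class_eq_iff)
  qed (simp add: thompson_positive_eq)
  then have "?f ` W \<subseteq> thompson_positive p \<inter> word_ball (thompson_group p) (thompson_gens p) n"
    by blast
  moreover have "inj_on ?f W"
    using inj_left_state by (rule inj_on_subset) (use assms in auto)
  ultimately show ?thesis
    unfolding positive_count_def
    using finite_word_ball_thompson[OF p_ge_2] by (metis card_inj_on_le finite_Int)
qed

lemma length_le_right_cost: "trimmed Rs \<Longrightarrow> length Rs \<le> right_cost Rs"
proof (induction Rs)
  case (Cons X Rs)
  then show ?case by (cases X) auto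
qed simp

lemma length_le_left_cost: "length Ss \<le> left_cost Ss"
  by (induction Ss) auto

lemma cost_le_right_cost: "X \<in> set Rs \<Longrightarrow> cost X \<le> right_cost Rs"
  by (induction Rs) (auto split: if_splits)

lemma cost_le_left_cost: "X \<in> set Ss \<Longrightarrow> cost X \<le> left_cost Ss"
  by (induction Ss) auto

abbreviation row_lists :: "nat \<Rightarrow> nat \<Rightarrow> row list set" where
  "row_lists d k \<equiv> {Rs. set Rs \<subseteq> rows d (p - 1) \<and> length Rs = k}"

lemma positive_count_le_card_states:
  "positive_count p n \<le> card {(Rs, Ss). Rs \<in> (\<Union>k\<le>n. row_lists n k) \<and> Ss \<in> (\<Union>k\<le>n. row_lists n k) \<and>
     right_cost Rs + left_cost Ss \<le> n}" (is "_ \<le> card ?S")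
proof -
  let ?f = "\<lambda>(Rs, Ss). pres_class (thompson_rels p) (positive_word (right_word Rs @ left_word Ss))"
  have fin: "finite ?S"
    by (rule finite_subset[of _ "(\<Union>k\<le>n. row_lists n k) \<times> (\<Union>k\<le>n. row_lists n k)"])
      (auto intro!: finite_cartesian_product finite_lists_length_eq)
  have "thompson_positive p \<inter> word_ball (thompson_group p) (thompson_gens p) n \<subseteq> ?f ` ?S"
  proof
    fix g assume "g \<in> thompson_positive p \<inter> word_ball (thompson_group p) (thompson_gens p) n"
    then obtain u W where g: "g = pres_class (thompson_rels p) (positive_word u)"
      "g = pres_class (thompson_rels p) W" and W: "fst ` set W \<subseteq> {..<p}" "length W \<le> n"
      unfolding thompson_positive_eq word_ball_thompson by blast
    then have "pres_eq (thompson_rels p) W (positive_word u)"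
      using pres_class_eq_iff by metis
    then obtain Rs Ss where *: "trimmed Rs" "wf_rows Rs" "wf_rows Ss"
      "pres_eq (thompson_rels p) W (positive_word (right_word Rs @ left_word Ss))"
      "right_cost Rs + left_cost Ss \<le> length W"
      using state_cost_le W(1) by blast
    have row: "X \<in> rows n (p - 1)" if "wf_row X" "cost X \<le> n" for X
      using in_rows[of X "p - 1" n] that carets_le_cost[of X] top_index_less[of X] by auto
    have "set Rs \<subseteq> rows n (p - 1)"
      using * W cost_le_right_cost by (fastforce intro!: row simp: wf_rows_def)
    moreover have "set Ss \<subseteq> rows n (p - 1)"
      using * W cost_le_left_cost by (fastforce intro!: row simp: wf_rows_def)
    ultimately have "(Rs, Ss) \<in> ?S"
      using * W length_le_right_cost[of Rs] length_le_left_cost[of Ss] by auto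
    moreover have "g = ?f (Rs, Ss)" using * g by (simp add: pres_class_eq_iff)
    ultimately show "g \<in> ?f ` ?S" by blast
  qed
  then have "positive_count p n \<le> card (?f ` ?S)"
    unfolding positive_count_def using fin by (intro card_mono) auto
  also have "\<dots> \<le> card ?S" using fin by (rule card_image_le)
  finally show ?thesis .
qed

end

section \<open>The row generating function at the critical weight\<close>

locale critical_weight = thompson +
  fixes z :: real
  assumes z_pos: "0 < z" and z_less: "z * real p < 1"
    and z_eq: "(1 - z\<^sup>2) ^ (p - 1) * (1 + z - z\<^sup>2) = 1"
begin

lemma z_half: "z < 1 / 2"
proof -
  have "z * 2 \<le> z * real p" using p_ge_2 z_pos by simp
  then show ?thesis using z_less by simp
qed

lemma z_sq: "0 < z\<^sup>2" "z\<^sup>2 < 1 / 4"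
proof -
  have "z * z < (1 / 2) * (1 / 2)" using z_half z_pos by (intro mult_strict_mono) auto
  then show "0 < z\<^sup>2" "z\<^sup>2 < 1 / 4" using z_pos by (auto simp: power2_eq_square)
qed

text \<open>Stationarity with z * row_sum = 1 makes the numbers 1 + z^2 (row_sum - 1) a geometric
  sequence in m with this ratio.\<close>

definition q :: real where "q = 1 / (1 - z\<^sup>2)"

lemma q_eq: "q - 1 = z\<^sup>2 * q" "1 \<le> q"
  using z_sq by (auto simp: q_def field_simps)

lemma sum_q: "z\<^sup>2 * (\<Sum>i=1..m. q ^ i) = q ^ m - 1"
proof (induction m)
  case (Suc m)
  have "z\<^sup>2 * (\<Sum>i=1..Suc m. q ^ i) = q ^ m - 1 + (z\<^sup>2 * q) * q ^ m"
    using Suc by (simp add: distrib_left mult_ac)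
  also have "\<dots> = q ^ m - 1 + (q - 1) * q ^ m" by (simp only: q_eq(1))
  also have "\<dots> = q ^ Suc m - 1" by (simp add: algebra_simps)
  finally show ?case .
qed simp

lemma q_pow: "q ^ (p - 1) = 1 + z - z\<^sup>2"
  using z_eq z_sq by (simp add: q_def power_one_over field_simps)

text \<open>The bounds \<open>1 + z\<^sup>2 (row_sum z d m - 1) \<le> q\<^sup>m\<close> are the values at which the recursion
  for \<open>row_sum\<close> is stationary when \<open>z * row_sum z d (p - 1) = 1\<close>.\<close>

lemma row_sum_le:
  "m < p \<Longrightarrow> 1 + z\<^sup>2 * (row_sum z d m - 1) \<le> q ^ m" "z * row_sum z d (p - 1) \<le> 1"
proof -
  have nonneg: "0 \<le> row_sum z d m" for d m
    unfolding row_sum_def using z_pos by (intro sum_nonneg) auto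
  \<comment> \<open>The case m = p - 1 of the bound: q^(p - 1) = 1 + z - z^2 turns it into z^2 *
    row_sum \<le> z. This closes the induction, which needs the bound on z * row_sum at depth
    d.\<close>
  have z_row: "z * row_sum z d (p - 1) \<le> 1"
    if "\<And>m. m < p \<Longrightarrow> 1 + z\<^sup>2 * (row_sum z d m - 1) \<le> q ^ m" for d
  proof -
    have "z * (z * row_sum z d (p - 1)) \<le> z * 1"
      using that[of "p - 1"] p_ge_2 q_pow by (simp add: power2_eq_square algebra_simps)
    then show ?thesis using z_pos by (rule mult_left_le_imp_le)
  qed
  have *: "1 + z\<^sup>2 * (row_sum z d m - 1) \<le> q ^ m" if "m < p" for d m
    using that
  proof (induction d arbitrary: m)
    case 0
    show ?case using q_eq by simp
  next
    case (Suc d)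
    have "(\<Sum>i=1..m. z * row_sum z d (p - 1) * (1 + z\<^sup>2 * (row_sum z d i - 1))) \<le> (\<Sum>i=1..m. 1 * q ^ i)"
    proof (intro sum_mono mult_mono)
      fix i assume i: "i \<in> {1..m}"
      show "z * row_sum z d (p - 1) \<le> 1" using z_row Suc.IH by blast
      show "1 + z\<^sup>2 * (row_sum z d i - 1) \<le> q ^ i" using Suc i by auto
      have "0 \<le> z\<^sup>2 * row_sum z d i" using nonneg by simp
      then show "0 \<le> 1 + z\<^sup>2 * (row_sum z d i - 1)" using z_sq by (simp add: algebra_simps)
    qed simp
    then have "z\<^sup>2 * (row_sum z (Suc d) m - 1) \<le> z\<^sup>2 * (\<Sum>i=1..m. q ^ i)"
      unfolding row_sum_Suc by (intro mult_left_mono) auto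
    then show ?case by (simp only: sum_q)
  qed
  then show "m < p \<Longrightarrow> 1 + z\<^sup>2 * (row_sum z d m - 1) \<le> q ^ m" .
  show "z * row_sum z d (p - 1) \<le> 1" using z_row * by blast
qed

lemma row_sum_convergent:
  assumes "m < p"
  shows "convergent (\<lambda>d. row_sum z d m)"
proof (rule Bseq_mono_convergent)
  have "row_sum z d m \<le> (q ^ m - 1) / z\<^sup>2 + 1" for d
    using row_sum_le(1)[OF assms, of d] z_sq by (simp add: field_simps)
  moreover have "0 \<le> row_sum z d m" for d
    unfolding row_sum_def using z_pos by (intro sum_nonneg) auto
  ultimately show "Bseq (\<lambda>d. row_sum z d m)"
    by (intro BseqI'[of _ "(q ^ m - 1) / z\<^sup>2 + 1"]) simp
  have "row_sum z d m \<le> row_sum z (Suc d) m" for d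
    unfolding row_sum_def by (intro sum_mono2 finite_rows rows_mono) (use z_pos in simp)
  then have "incseq (\<lambda>d. row_sum z d m)" by (rule incseq_SucI)
  then show "\<forall>a b. a \<le> b \<longrightarrow> row_sum z a m \<le> row_sum z b m"
    by (simp only: incseq_def)
qed

text \<open>The limit satisfies the stationary equation for some \<open>u = z * lim row_sum\<close>, and \<open>u = 1\<close>
  is its only solution in \<open>[0, 1]\<close>.\<close>

lemma row_sum_tendsto: "(\<lambda>d. row_sum z d (p - 1)) \<longlonglongrightarrow> 1 / z"
proof -
  define A where "A m = lim (\<lambda>d. row_sum z d m)" for m
  have A: "(\<lambda>d. row_sum z d m) \<longlonglongrightarrow> A m" if "m < p" for m
    using row_sum_convergent[OF that] unfolding A_def by (simp add: convergent_LIMSEQ_iff)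
  define u where "u = z * A (p - 1)"
  define b where "b m = 1 + z\<^sup>2 * (A m - 1)" for m
  have A_eq: "A m = 1 + (\<Sum>i=1..m. u * b i)" if "m < p" for m
  proof (rule LIMSEQ_unique)
    show "(\<lambda>d. row_sum z (Suc d) m) \<longlonglongrightarrow> A m" using A[OF that] by (rule LIMSEQ_Suc)
    show "(\<lambda>d. row_sum z (Suc d) m) \<longlonglongrightarrow> 1 + (\<Sum>i=1..m. u * b i)"
      unfolding row_sum_Suc u_def b_def
      using that p_ge_2 by (intro tendsto_intros A) auto
  qed
  \<comment> \<open>Subtracting consecutive stationary equations gives b (m + 1) (1 - u z^2) = b m,
    a geometric sequence again, now for unknown u.\<close>
  have b: "b m * (1 - u * z\<^sup>2) ^ m = 1" if "m < p" for m
    using that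
  proof (induction m)
    case 0
    then show ?case using A_eq[of 0] by (simp add: b_def)
  next
    case (Suc m)
    have "A (Suc m) = A m + u * b (Suc m)" using A_eq[of m] A_eq[of "Suc m"] Suc by simp
    then have "b (Suc m) = 1 + z\<^sup>2 * (A m + u * b (Suc m) - 1)"
      by (simp only: b_def[of "Suc m"])
    also have "\<dots> = b m + z\<^sup>2 * u * b (Suc m)"
      by (simp only: b_def[of m]) (simp add: algebra_simps)
    finally have "b (Suc m) * (1 - u * z\<^sup>2) = b m" by (simp add: algebra_simps)
    then have "b (Suc m) * (1 - u * z\<^sup>2) ^ Suc m = b m * (1 - u * z\<^sup>2) ^ m"
      by (metis mult.assoc power_Suc)
    then show ?case using Suc by simp
  qed
  have u_eq: "(1 + z * u - z\<^sup>2) * (1 - u * z\<^sup>2) ^ (p - 1) = 1"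
    using b[of "p - 1"] p_ge_2 by (simp add: b_def u_def power2_eq_square algebra_simps)
  have u_le: "u \<le> 1"
  proof (rule LIMSEQ_le_const2)
    show "(\<lambda>d. z * row_sum z d (p - 1)) \<longlonglongrightarrow> u"
      unfolding u_def using p_ge_2 by (intro tendsto_intros A) simp
  qed (use row_sum_le(2) in blast)
  have u_ge: "0 \<le> u"
  proof (rule LIMSEQ_le_const)
    show "(\<lambda>d. z * row_sum z d (p - 1)) \<longlonglongrightarrow> u"
      unfolding u_def using p_ge_2 by (intro tendsto_intros A) simp
    show "\<exists>N. \<forall>n\<ge>N. 0 \<le> z * row_sum z n (p - 1)"
      unfolding row_sum_def using z_pos by (auto intro!: sum_nonneg mult_nonneg_nonneg)
  qed
  have "u = 1"
  proof (rule ccontr)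
    assume "u \<noteq> 1"
    then have u: "u < 1" using u_le by simp
    \<comment> \<open>Chosen so that 1 - u z^2 = (1 - z^2)(1 + s); the equation for u can then be
      compared with \<open>z_eq\<close>, and Bernoulli at -s bounds the power of 1 + s from the
      needed side.\<close>
    define s where "s = (1 - u) * z\<^sup>2 / (1 - z\<^sup>2)"
    have s0: "0 \<le> s" using u z_sq by (simp add: s_def)
    have s1: "s \<le> 1"
    proof -
      have "(1 - u) * z\<^sup>2 \<le> 1 * z\<^sup>2" using u_ge z_sq by (intro mult_right_mono) auto
      then have "(1 - u) * z\<^sup>2 \<le> 1 - z\<^sup>2" using z_sq by linarith
      then show ?thesis using z_sq by (simp only: s_def divide_le_eq) simp
    qed
    have s_mult: "s * (1 - z\<^sup>2) = (1 - u) * z\<^sup>2" using z_sq by (simp add: s_def)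
    have split: "1 - u * z\<^sup>2 = (1 - z\<^sup>2) * (1 + s)"
      using s_mult by (simp add: algebra_simps)
    have "(1 + real (p - 1) * (- s)) * (1 + s) ^ (p - 1) \<le> (1 + - s) ^ (p - 1) * (1 + s) ^ (p - 1)"
      using s0 s1 Bernoulli_inequality[of "- s" "p - 1"] by (intro mult_right_mono) auto
    also have "\<dots> = (1 - s * s) ^ (p - 1)"
      by (simp flip: power_mult_distrib add: algebra_simps)
    also have "\<dots> \<le> 1" using s0 s1 mult_le_one[of s s] by (intro power_le_one) auto
    finally have bern: "(1 - real (p - 1) * s) * (1 + s) ^ (p - 1) \<le> 1" by simp
    let ?E = "(1 - z\<^sup>2) ^ (p - 1) * (1 + s) ^ (p - 1)"
    have E: "?E * (1 + z * u - z\<^sup>2) = 1" using u_eq by (simp add: split power_mult_distrib mult_ac)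
    have E_pos: "0 < ?E" using z_sq s0 by simp
    have "?E * ((1 + z - z\<^sup>2) * (1 - real (p - 1) * s))
        = ((1 - z\<^sup>2) ^ (p - 1) * (1 + z - z\<^sup>2)) * ((1 - real (p - 1) * s) * (1 + s) ^ (p - 1))"
      by (simp add: mult_ac)
    also have "\<dots> = (1 - real (p - 1) * s) * (1 + s) ^ (p - 1)" by (simp only: z_eq mult_1_left)
    also have "\<dots> \<le> ?E * (1 + z * u - z\<^sup>2)" using bern by (simp only: E)
    finally have "(1 + z - z\<^sup>2) * (1 - real (p - 1) * s) \<le> 1 + z * u - z\<^sup>2"
      using E_pos by (simp only: mult_le_cancel_left_pos)
    then have "z * (1 - u) \<le> real (p - 1) * s * (1 + z - z\<^sup>2)" by (simp add: algebra_simps)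
    then have "z * (1 - u) * (1 - z\<^sup>2) \<le> real (p - 1) * s * (1 + z - z\<^sup>2) * (1 - z\<^sup>2)"
      using z_sq by (intro mult_right_mono) auto
    also have "\<dots> = real (p - 1) * (1 + z - z\<^sup>2) * (s * (1 - z\<^sup>2))" by (simp add: mult_ac)
    also have "\<dots> = z * (1 - u) * (real (p - 1) * z * (1 + z - z\<^sup>2))"
      unfolding s_mult by (simp add: power2_eq_square mult_ac)
    finally have "1 - z\<^sup>2 \<le> real (p - 1) * z * (1 + z - z\<^sup>2)"
      using u z_pos by (simp only: mult_le_cancel_left_pos mult_pos_pos diff_gt_0_iff_gt)
    also have "\<dots> = z * real p * (1 + z - z\<^sup>2) - z * (1 + z - z\<^sup>2)"
      using p_ge_2 by (simp add: of_nat_diff algebra_simps)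
    \<comment> \<open>Here \<open>z_less\<close> rules out a second stationary value u < 1.\<close>
    also have "\<dots> < 1 * (1 + z - z\<^sup>2) - z * (1 + z - z\<^sup>2)"
      using z_less z_sq z_pos by (intro diff_strict_right_mono mult_strict_right_mono) auto
    also have "\<dots> = 1 - z\<^sup>2 - z\<^sup>2 * (1 - z)" by (simp add: power2_eq_square algebra_simps)
    also have "\<dots> \<le> 1 - z\<^sup>2" using z_sq z_half by simp
    finally show False by simp
  qed
  then have "A (p - 1) = 1 / z" using z_pos by (simp add: u_def field_simps)
  then show ?thesis using A[of "p - 1"] p_ge_2 by simp
qed

section \<open>Upper and lower bounds for the count\<close>

text \<open>The first row contributes at most 1 / z, and every further one the factor z^2 * (1 / z)
  = z \<le> 1, so the bound is uniform in the length.\<close>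

lemma sum_right_cost_le: "(\<Sum>Rs\<in>row_lists d k. z ^ right_cost Rs) \<le> 1 / z"
proof (induction k)
  case 0
  have "{Rs. set Rs \<subseteq> rows d (p - 1) \<and> length Rs = 0} = {[]}" by auto
  then show ?case using z_pos z_half by simp
next
  case (Suc k)
  have r: "(\<Sum>X\<in>rows d (p - 1). z ^ cost X) \<le> 1 / z"
    using row_sum_le(2)[of d] z_pos by (simp add: row_sum_def field_simps)
  show ?case
  proof (cases k)
    case 0
    have "{Rs. set Rs \<subseteq> rows d (p - 1) \<and> length Rs = 0} = {[]}" by auto
    then show ?thesis using r 0 by (simp add: sum_lists_length_Suc)
  next
    case (Suc l)
    have "(\<Sum>Rs\<in>row_lists d (Suc k). z ^ right_cost Rs)
        = (\<Sum>X\<in>rows d (p - 1). \<Sum>Rs\<in>row_lists d k. z ^ cost X * (z\<^sup>2 * z ^ right_cost Rs))"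
      unfolding sum_lists_length_Suc[OF finite_rows] using Suc
      by (intro sum.cong HOL.refl) (auto simp: power_add power2_eq_square)
    also have "\<dots> = (\<Sum>X\<in>rows d (p - 1). z ^ cost X) * (z\<^sup>2 * (\<Sum>Rs\<in>row_lists d k. z ^ right_cost Rs))"
      unfolding sum_distrib_left[of "z\<^sup>2"] sum_product ..
    also have "\<dots> \<le> (1 / z) * (z\<^sup>2 * (1 / z))"
      using r Suc.IH z_pos by (intro mult_mono mult_left_mono) (auto intro!: sum_nonneg mult_nonneg_nonneg)
    also have "\<dots> \<le> 1 / z" using z_pos z_half by (simp add: power2_eq_square)
    finally show ?thesis .
  qed
qed

lemma sum_left_cost_le: "(\<Sum>Ss\<in>row_lists d k. z ^ left_cost Ss) \<le> 1"
proof (induction k)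
  case 0
  have "{Rs. set Rs \<subseteq> rows d (p - 1) \<and> length Rs = 0} = {[]}" by auto
  then show ?case by simp
next
  case (Suc k)
  have "(\<Sum>Ss\<in>row_lists d (Suc k). z ^ left_cost Ss)
      = (\<Sum>X\<in>rows d (p - 1). \<Sum>Ss\<in>row_lists d k. (z * z ^ cost X) * z ^ left_cost Ss)"
    unfolding sum_lists_length_Suc[OF finite_rows]
    by (intro sum.cong HOL.refl) (auto simp: power_add)
  also have "\<dots> = (z * row_sum z d (p - 1)) * (\<Sum>Ss\<in>row_lists d k. z ^ left_cost Ss)"
    unfolding row_sum_def sum_distrib_left[of z] sum_product ..
  also have "\<dots> \<le> 1 * 1"
    using Suc.IH row_sum_le(2)[of d] z_pos by (intro mult_mono) (auto intro!: sum_nonneg)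
  finally show ?case by simp
qed

text \<open>Each state of cost at most n has weight at least z^n. The two list lengths take n + 1
  values each, which yields the quadratic factor.\<close>

lemma positive_count_upper:
  "real (positive_count p n) \<le> (real n + 1)\<^sup>2 / z * (1 / z) ^ n"
proof -
  let ?L = "\<Union>k\<le>n. row_lists n k"
  let ?S = "{(Rs, Ss). Rs \<in> ?L \<and> Ss \<in> ?L \<and> right_cost Rs + left_cost Ss \<le> n}"
  have finL: "finite ?L" by (auto intro!: finite_lists_length_eq)
  have L_sum: "sum f ?L = (\<Sum>k\<le>n. sum f (row_lists n k))" for f :: "row list \<Rightarrow> real"
    by (intro sum.UNION_disjoint) (auto intro!: finite_lists_length_eq)
  have fin: "finite ?S"
    by (rule finite_subset[of _ "?L \<times> ?L"]) (use finL in auto)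
  have "real (card ?S) * z ^ n = (\<Sum>s\<in>?S. z ^ n)" by simp
  also have "\<dots> \<le> (\<Sum>(Rs, Ss)\<in>?S. z ^ right_cost Rs * z ^ left_cost Ss)"
    using z_pos z_half by (intro sum_mono) (auto simp flip: power_add intro: power_decreasing)
  also have "\<dots> \<le> (\<Sum>(Rs, Ss)\<in>?L \<times> ?L. z ^ right_cost Rs * z ^ left_cost Ss)"
    using finL z_pos by (intro sum_mono2) auto
  also have "\<dots> = (\<Sum>Rs\<in>?L. z ^ right_cost Rs) * (\<Sum>Ss\<in>?L. z ^ left_cost Ss)"
    by (simp only: sum_product sum.cartesian_product)
  also have "\<dots> \<le> (\<Sum>k\<le>n. 1 / z) * (\<Sum>k\<le>n. 1)"
    unfolding L_sum using z_pos
    by (intro mult_mono sum_mono sum_right_cost_le sum_left_cost_le) (auto intro!: sum_nonneg)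
  also have "\<dots> = (real n + 1)\<^sup>2 / z"
    by (simp add: power2_eq_square add_divide_distrib algebra_simps)
  finally have "real (card ?S) \<le> (real n + 1)\<^sup>2 / z * (1 / z) ^ n"
    using z_pos by (simp add: field_simps)
  moreover have "real (positive_count p n) \<le> real (card ?S)"
    using positive_count_le_card_states by simp
  ultimately show ?thesis by linarith
qed

text \<open>A renewal argument: below 1 / z some finite depth already gives the steps
  \<open>Suc (cost X)\<close> total weight at least 1 at 1 / y. Prepending a row then carries the
  lower bound y^(n - M) from smaller n to n.\<close>

lemma positive_count_lower:
  assumes "1 \<le> y" "y < 1 / z"
  obtains c where "0 < c" "\<And>n. c * y ^ n \<le> real (positive_count p n)"
proof -
  have "eventually (\<lambda>d. y < row_sum z d (p - 1)) sequentially"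
    using row_sum_tendsto assms(2) by (rule order_tendstoD)
  then obtain d where d: "y < row_sum z d (p - 1)"
    by (auto simp: eventually_sequentially)
  let ?B = "rows d (p - 1)"
  have y: "z \<le> 1 / y" using assms z_pos by (simp add: field_simps)
  have "1 < (1 / y) * row_sum z d (p - 1)" using d assms by simp
  also have "\<dots> \<le> (1 / y) * (\<Sum>X\<in>?B. (1 / y) ^ cost X)"
    unfolding row_sum_def using assms y z_pos
    by (intro mult_left_mono sum_mono power_mono) auto
  finally have ge: "1 \<le> (\<Sum>X\<in>?B. (1 / y) ^ Suc (cost X))" by (simp add: sum_distrib_left)
  \<comment> \<open>The largest step: for n \<ge> M no subtraction n - \<open>Suc (cost X)\<close>
    is truncated, and for n < M one list of trivial rows is enough.\<close>
  define M where "M = Suc (Max (cost ` ?B))"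
  have M: "Suc (cost X) \<le> M" if "X \<in> ?B" for X
    using that by (auto simp: M_def)
  define W where "W n = {Ss. set Ss \<subseteq> ?B \<and> left_cost Ss = n}" for n
  have finW: "finite (W n)" for n
  proof (rule finite_subset)
    show "W n \<subseteq> {Ss. set Ss \<subseteq> ?B \<and> length Ss \<le> n}"
      using length_le_left_cost by (auto simp: W_def)
  qed (simp add: finite_lists_length_le)
  have "y ^ n / y ^ M \<le> real (card (W n))" for n
  proof (induction n rule: less_induct)
    case (less n)
    show ?case
    proof (cases "n < M")
      case True
      have "left_cost (replicate n Triv) = n" by (induction n) auto
      then have "replicate n Triv \<in> W n" by (auto simp: W_def)
      then have "0 < card (W n)" using finW by (auto simp: card_gt_0_iff)
      moreover have "y ^ n / y ^ M \<le> 1" using assms True by (simp add: power_increasing)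
      ultimately show ?thesis by linarith
    next
      case False
      let ?r = "\<lambda>X. n - Suc (cost X)"
      have r: "y ^ ?r X = y ^ n * (1 / y) ^ Suc (cost X)" if "X \<in> ?B" for X
        using M[OF that] False assms(1)
        by (subst power_diff) (auto simp: power_one_over field_simps)
      have "y ^ n / y ^ M * 1 \<le> y ^ n / y ^ M * (\<Sum>X\<in>?B. (1 / y) ^ Suc (cost X))"
        using ge assms by (intro mult_left_mono) auto
      also have "\<dots> = (\<Sum>X\<in>?B. y ^ ?r X / y ^ M)"
        unfolding sum_distrib_left by (intro sum.cong HOL.refl) (simp only: r times_divide_eq_left)
      also have "\<dots> \<le> (\<Sum>X\<in>?B. real (card (W (?r X))))"
      proof (rule sum_mono)
        fix X assume "X \<in> ?B"
        then have "?r X < n" using M[of X] False by simp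
        then show "y ^ ?r X / y ^ M \<le> real (card (W (?r X)))" by (rule less.IH)
      qed
      also have "\<dots> = real (card (\<Union>X\<in>?B. (#) X ` W (?r X)))"
        by (subst card_UN_disjoint) (auto simp: finW card_image inj_on_def)
      also have "\<dots> \<le> real (card (W n))"
      proof -
        have "(\<Union>X\<in>?B. (#) X ` W (?r X)) \<subseteq> W n"
          using M False by (fastforce simp: W_def)
        then show ?thesis using card_mono[OF finW] by simp
      qed
      finally show ?thesis by simp
    qed
  qed
  moreover have "card (W n) \<le> positive_count p n" for n
    using wf_rows_rows[of _ d "p - 1"] p_ge_2
    by (intro card_left_states_le_positive_count) (auto simp: W_def wf_rows_def)
  ultimately have "1 / y ^ M * y ^ n \<le> real (positive_count p n)" for n
    by (metis (no_types, lifting) mult_1 of_nat_le_iff order_trans times_divide_eq_left)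
  then show ?thesis using that[of "1 / y ^ M"] assms by simp
qed

lemma root_positive_count_tendsto:
  "(\<lambda>n. root n (real (positive_count p n))) \<longlonglongrightarrow> 1 / z"
proof (rule order_tendstoI)
  fix a assume a: "a < 1 / z"
  have "1 < 1 / z" using z_pos z_half by simp
  with a obtain y where y: "max a 1 < y" "y < 1 / z" using dense[of "max a 1" "1 / z"] by auto
  then obtain c where c: "0 < c" "\<And>n. c * y ^ n \<le> real (positive_count p n)"
    using positive_count_lower[of y] by auto
  have "(\<lambda>n. root n c * y) \<longlonglongrightarrow> 1 * y"
    using c by (intro tendsto_intros LIMSEQ_root_const)
  then have "eventually (\<lambda>n. a < root n c * y) sequentially"
    using y by (intro order_tendstoD(1)[of _ "1 * y"]) auto
  then show "eventually (\<lambda>n. a < root n (real (positive_count p n))) sequentially"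
    using eventually_gt_at_top[of 0]
  proof eventually_elim
    case (elim n)
    have "root n c * y = root n (c * y ^ n)"
      using elim y by (simp add: real_root_mult real_root_power_cancel)
    also have "\<dots> \<le> root n (real (positive_count p n))"
      using elim c by (intro real_root_le_mono) auto
    finally show ?case using elim by simp
  qed
next
  fix a assume a: "1 / z < a"
  have "(\<lambda>n. root n (4 / z) * (root n (real n))\<^sup>2 * (1 / z)) \<longlonglongrightarrow> 1 * 1\<^sup>2 * (1 / z)"
    using z_pos by (intro tendsto_intros LIMSEQ_root_const LIMSEQ_root) auto
  then have "eventually (\<lambda>n. root n (4 / z) * (root n (real n))\<^sup>2 * (1 / z) < a) sequentially"
    using a by (intro order_tendstoD(2)[of _ "1 * 1\<^sup>2 * (1 / z)"]) auto
  then show "eventually (\<lambda>n. root n (real (positive_count p n)) < a) sequentially"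
    using eventually_gt_at_top[of 0]
  proof eventually_elim
    case (elim n)
    \<comment> \<open>Leaves a monomial in n, whose nth root is explicit; the 4 joins the
      constant.\<close>
    have "(real n + 1)\<^sup>2 \<le> (2 * real n)\<^sup>2" using elim by (intro power_mono) auto
    then have "(real n + 1)\<^sup>2 / z * (1 / z) ^ n \<le> 4 / z * (real n)\<^sup>2 * (1 / z) ^ n"
      using z_pos by (intro mult_right_mono) (auto simp: divide_right_mono power_mult_distrib)
    then have "root n (real (positive_count p n)) \<le> root n (4 / z * (real n)\<^sup>2 * (1 / z) ^ n)"
      using positive_count_upper[of n] elim by (intro real_root_le_mono) auto
    also have "\<dots> = root n (4 / z) * (root n (real n))\<^sup>2 * (1 / z)"
      using real_root_power_cancel[of n "1 / z"] real_root_power[of n "real n" 2] elim z_pos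
      by (simp only: real_root_mult) simp
    finally show ?case using elim by simp
  qed
qed

end

section \<open>Locating the growth rate\<close>

text \<open>The intermediate value theorem supplies a root 1 / y of \<open>charfun p z = 1\<close>;
  y > y0 \<ge> p is exactly what makes it an admissible critical weight.\<close>

lemma positive_growth_between:
  assumes "2 \<le> p" "real p \<le> y0" "y0 < y1" "charfun p (1 / y0) < 1" "1 < charfun p (1 / y1)"
  obtains y where "y0 < y" "y < y1"
    "(\<lambda>n. root n (real (positive_count p n))) \<longlonglongrightarrow> y"
    "(y\<^sup>2 - 1) ^ (p - 1) * (y\<^sup>2 + y - 1) = y ^ (2 * p)"
proof -
  have y0: "0 < y0" using assms by linarith
  have le: "1 / y1 \<le> 1 / y0" using assms y0 by (intro divide_left_mono) auto
  have "continuous_on {1 / y1..1 / y0} (charfun p)"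
    unfolding charfun_def by (intro continuous_intros)
  then obtain z where z: "1 / y1 \<le> z" "z \<le> 1 / y0" "charfun p z = 1"
    using IVT2'[of "charfun p" "1 / y0" 1 "1 / y1"] assms le by auto
  then have z': "1 / y1 < z" "z < 1 / y0" using assms by (auto simp: order_less_le)
  have z_pos: "0 < z" using z' assms y0 by (meson divide_pos_pos less_trans zero_less_one)
  interpret critical_weight p z
  proof
    have "z * real p \<le> z * y0" using assms z_pos by simp
    also have "\<dots> < 1" using z'(2) y0 by (simp add: field_simps)
    finally show "z * real p < 1" .
  qed (use assms z_pos z in \<open>auto simp: charfun_def\<close>)
  define y where "y = 1 / z"
  have y: "y0 < y" "y < y1" "z = 1 / y" "0 < y"
    using z' z_pos y0 assms by (auto simp: y_def field_simps)
  have "y\<^sup>2 - 1 = y\<^sup>2 * (1 - z\<^sup>2)" "y\<^sup>2 + y - 1 = y\<^sup>2 * (1 + z - z\<^sup>2)"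
    using z_pos by (auto simp: y_def field_simps power2_eq_square)
  then have "(y\<^sup>2 - 1) ^ (p - 1) * (y\<^sup>2 + y - 1)
      = (y\<^sup>2 * (y\<^sup>2) ^ (p - 1)) * charfun p z"
    by (simp add: charfun_def power_mult_distrib mult_ac)
  also have "\<dots> = (y\<^sup>2) ^ Suc (p - 1)" using z by simp
  also have "\<dots> = y ^ (2 * p)" using assms(1) by (simp add: power_mult)
  finally have eq: "(y\<^sup>2 - 1) ^ (p - 1) * (y\<^sup>2 + y - 1) = y ^ (2 * p)" .
  show ?thesis
    using y(1,2) root_positive_count_tendsto[folded y_def] eq by (rule that)
qed

theorem theorem4p4:
  "(\<forall>p\<ge>2. (\<lambda>n. root n (real (positive_count p n))) \<longlonglongrightarrow> positive_growth_rate p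
      \<and> ((positive_growth_rate p)\<^sup>2 - 1) ^ (p - 1)
          * ((positive_growth_rate p)\<^sup>2 + positive_growth_rate p - 1)
        = positive_growth_rate p ^ (2 * p))
    \<and> (\<exists>lam :: nat \<Rightarrow> real.
        (\<forall>p\<ge>2. positive_growth_rate p = real p + lam p \<and> 0 < lam p \<and> lam p < 1 / 2)
        \<and> lam \<longlonglongrightarrow> 1 / 2)"
proof -
  have rate: "positive_growth_rate p = y"
    if "(\<lambda>n. root n (real (positive_count p n))) \<longlonglongrightarrow> y" for p y
    using that unfolding positive_growth_rate_def by (rule limI)
  have main: "(\<lambda>n. root n (real (positive_count p n))) \<longlonglongrightarrow> positive_growth_rate p
      \<and> ((positive_growth_rate p)\<^sup>2 - 1) ^ (p - 1)
          * ((positive_growth_rate p)\<^sup>2 + positive_growth_rate p - 1)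
        = positive_growth_rate p ^ (2 * p)
      \<and> real p < positive_growth_rate p \<and> positive_growth_rate p < real p + 1 / 2"
    if p: "2 \<le> p" for p
  proof -
    obtain y where "real p < y" "y < real p + 1 / 2"
      "(\<lambda>n. root n (real (positive_count p n))) \<longlonglongrightarrow> y"
      "(y\<^sup>2 - 1) ^ (p - 1) * (y\<^sup>2 + y - 1) = y ^ (2 * p)"
      using positive_growth_between[of p "real p" "real p + 1 / 2"]
        charfun_at_p[OF p] charfun_at_p_half[OF p] p by auto
    then show ?thesis using rate by simp
  qed
  define lam where "lam p = positive_growth_rate p - real p" for p
  have "eventually (\<lambda>p. 1 / 2 - 1 / real p \<le> lam p) sequentially"
    using eventually_charfun_less_1 eventually_ge_at_top[of 2]
  proof eventually_elim
    case (elim p)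
    \<comment> \<open>Ensures that the lower end p + 1/2 - 1/p is at least p and below the upper
      end.\<close>
    have "1 / real p \<le> 1 / 2" "0 < 1 / real p" using elim by auto
    then obtain y where "real p + 1 / 2 - 1 / real p < y"
      "(\<lambda>n. root n (real (positive_count p n))) \<longlonglongrightarrow> y"
      using positive_growth_between[of p "real p + 1 / 2 - 1 / real p" "real p + 1 / 2"]
        charfun_at_p_half[of p] elim by auto
    then show ?case using rate by (simp add: lam_def)
  qed
  moreover have "eventually (\<lambda>p. lam p \<le> 1 / 2) sequentially"
    using eventually_ge_at_top[of 2] by eventually_elim (use main in \<open>fastforce simp: lam_def\<close>)
  moreover have "(\<lambda>p. 1 / 2 - 1 / real p) \<longlonglongrightarrow> 1 / 2 - 0"
    by (intro tendsto_intros lim_1_over_n)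
  ultimately have "lam \<longlonglongrightarrow> 1 / 2"
    by (intro tendsto_sandwich[of "\<lambda>p. 1 / 2 - 1 / real p" lam sequentially "\<lambda>_. 1 / 2"]) auto
  moreover have "\<forall>p\<ge>2. positive_growth_rate p = real p + lam p \<and> 0 < lam p \<and> lam p < 1 / 2"
    using main by (fastforce simp: lam_def)
  ultimately show ?thesis using main by blast
qed

end
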